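(* Let $n\geq1$ and let $\rho$ be the Poincaré pseudohyperbolic metric on the open unit ball $\mathbb{B}_n$ of $\mathbb{C}^n$. For any $z,w\in\mathbb{B}_n$ we have $$\rho(z,w)=\max\left\{|\varphi(z)|:\varphi\in F_n^\infty\text{ with }\|\varphi\|_{F_n^\infty}\leq1\text{ and }\varphi(w)=0\right\}.$$
   Context: The pseudohyperbolic distance $\rho(z,w)$ is the Euclidean distance between $0$ and $\psi(w)$, where $\psi$ is any biholomorphic map of $\mathbb{B}_n$ onto itself with $\psi(z)=0$ (the value is independent of the choice of $\psi$). The full Fock space $F_n^2=\bigoplus_{k\geq 0}(\mathbb{C}^n)^{\otimes k}$ (Hilbert space direct sum, $(\mathbb{C}^n)^{\otimes 0}=\mathbb{C}1$) carries the left creation operators $S_j\xi=e_j\otimes\xi$, $S_j(1)=e_j$, $j=1,\dots,n$, where $(e_j)$ is the canonical basis of $\mathbb{C}^n$. The noncommutative Hardy algebra $F_n^\infty$ is the weak-operator closure of the algebra generated by $1,S_1,\dots,S_n$ in the bounded operators on $F_n^2$, with the operator norm $\|\cdot\|_{F_n^\infty}$. It is a dual space, whose weak* topology is the restriction of the weak operator topology. For each $\lambda\in\mathbb{B}_n$ there is a unique weak* continuous unital algebra homomorphism $\pi_\lambda:F_n^\infty\to\mathbb{C}$ with $\pi_\lambda(S_j)=\lambda_j$ for all $j$; one writes $\varphi(\lambda)=\pi_\lambda(\varphi)$. *)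

theory Defs
  imports "HOL-Analysis.Analysis"
begin

definition is_maximum :: "real \<Rightarrow> real set \<Rightarrow> bool" where
  "is_maximum m A \<longleftrightarrow> m \<in> A \<and> (\<forall>a\<in>A. a \<le> m)"


section \<open>The full Fock space\<close>

text \<open>
  For a finite type \<open>'n\<close> with \<open>n\<close> elements, \<open>(\<complex>\<^sup>n)\<^sup>\<otimes>\<^sup>k\<close> is represented by its coordinates in the
  orthonormal basis \<open>e i\<^sub>1 \<otimes> \<dots> \<otimes> e i\<^sub>k\<close>, which is indexed by the words \<open>[i\<^sub>1, \<dots>, i\<^sub>k]\<close> of length
  \<open>k\<close> over \<open>'n\<close> (the empty word standing for the vacuum vector \<open>1\<close>).  The Hilbert space direct sum
  over all \<open>k\<close> is then the space of square-summable families indexed by all words.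
\<close>

typedef 'n fock = "{x :: 'n list \<Rightarrow> complex. (\<lambda>w. (cmod (x w))\<^sup>2) summable_on UNIV}"
  morphisms coord Abs_fock
  by (rule exI[of _ "\<lambda>_. 0"]) simp

setup_lifting type_definition_fock

lemma coord_summable: "(\<lambda>w. (cmod (coord x w))\<^sup>2) summable_on UNIV"
  using coord[of x] by simp

lemma square_summable_add:
  fixes f g :: "'b \<Rightarrow> complex"
  assumes "(\<lambda>w. (cmod (f w))\<^sup>2) summable_on A" "(\<lambda>w. (cmod (g w))\<^sup>2) summable_on A"
  shows "(\<lambda>w. (cmod (f w + g w))\<^sup>2) summable_on A"
proof (rule summable_on_comparison_test)
  show "(\<lambda>w. 2 * ((cmod (f w))\<^sup>2 + (cmod (g w))\<^sup>2)) summable_on A"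
    by (intro summable_on_cmult_right summable_on_add assms)
  fix w
  have "(cmod (f w + g w))\<^sup>2 \<le> (cmod (f w) + cmod (g w))\<^sup>2"
    by (intro power_mono norm_triangle_ineq) auto
  also have "\<dots> \<le> 2 * ((cmod (f w))\<^sup>2 + (cmod (g w))\<^sup>2)"
    using sum_squares_bound[of "cmod (f w)" "cmod (g w)"] by (simp add: power2_sum)
  finally show "(cmod (f w + g w))\<^sup>2 \<le> 2 * ((cmod (f w))\<^sup>2 + (cmod (g w))\<^sup>2)" .
qed auto

lemma square_summable_cmult:
  fixes f :: "'b \<Rightarrow> complex"
  assumes "(\<lambda>w. (cmod (f w))\<^sup>2) summable_on A"
  shows "(\<lambda>w. (cmod (c * f w))\<^sup>2) summable_on A"
  using summable_on_cmult_right[OF assms, of "(cmod c)\<^sup>2"] by (simp add: norm_mult power_mult_distrib)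

lemma square_summable_product:
  fixes f g :: "'b \<Rightarrow> complex"
  assumes "(\<lambda>w. (cmod (f w))\<^sup>2) summable_on A" "(\<lambda>w. (cmod (g w))\<^sup>2) summable_on A"
  shows "(\<lambda>w. f w * cnj (g w)) summable_on A"
proof (rule abs_summable_summable, rule summable_on_comparison_test)
  show "(\<lambda>w. (cmod (f w))\<^sup>2 + (cmod (g w))\<^sup>2) summable_on A"
    by (intro summable_on_add assms)
  fix w
  show "norm (f w * cnj (g w)) \<le> (cmod (f w))\<^sup>2 + (cmod (g w))\<^sup>2"
    using sum_squares_bound[of "cmod (f w)" "cmod (g w)"]
      mult_nonneg_nonneg[OF norm_ge_zero[of "f w"] norm_ge_zero[of "g w"]]
    unfolding norm_mult complex_mod_cnj by linarith
qed auto

instantiation fock :: (type) real_vector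
begin

lift_definition zero_fock :: "'a fock" is "\<lambda>_. 0" by simp
lift_definition plus_fock :: "'a fock \<Rightarrow> 'a fock \<Rightarrow> 'a fock" is "\<lambda>x y w. x w + y w"
  by (rule square_summable_add)
lift_definition uminus_fock :: "'a fock \<Rightarrow> 'a fock" is "\<lambda>x w. - x w" by simp
lift_definition minus_fock :: "'a fock \<Rightarrow> 'a fock \<Rightarrow> 'a fock" is "\<lambda>x y w. x w - y w"
  subgoal for f g using square_summable_add[of f UNIV "\<lambda>w. - g w"] by simp
  done
lift_definition scaleR_fock :: "real \<Rightarrow> 'a fock \<Rightarrow> 'a fock" is "\<lambda>r x w. r *\<^sub>R x w"
  unfolding scaleR_conv_of_real by (rule square_summable_cmult)

instance
  by standard (transfer; simp add: fun_eq_iff algebra_simps)+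

end

lift_definition fock_scale :: "complex \<Rightarrow> 'n fock \<Rightarrow> 'n fock" (infixr "\<cdot>\<^sub>F" 75)
  is "\<lambda>c x w. c * x w"
  by (rule square_summable_cmult)

definition fock_inner :: "'n fock \<Rightarrow> 'n fock \<Rightarrow> complex" where
  "fock_inner x y = (\<Sum>\<^sub>\<infinity>w. coord x w * cnj (coord y w))"

lemma fock_inner_summable: "(\<lambda>w. coord x w * cnj (coord y w)) summable_on UNIV"
  by (intro square_summable_product coord_summable)

lemma fock_inner_self: "fock_inner x x = of_real (\<Sum>\<^sub>\<infinity>w. (cmod (coord x w))\<^sup>2)"
  unfolding fock_inner_def complex_norm_square[symmetric]
  using has_sum_of_real[OF has_sum_infsum[OF coord_summable[of x]], where 'a = complex]
  by (simp add: infsumI)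

instantiation fock :: (type) real_inner
begin

definition inner_fock :: "'a fock \<Rightarrow> 'a fock \<Rightarrow> real" where
  "inner_fock x y = Re (fock_inner x y)"
definition norm_fock :: "'a fock \<Rightarrow> real" where
  "norm_fock x = sqrt (inner x x)"
definition sgn_fock :: "'a fock \<Rightarrow> 'a fock" where
  "sgn_fock x = inverse (norm x) *\<^sub>R x"
definition dist_fock :: "'a fock \<Rightarrow> 'a fock \<Rightarrow> real" where
  "dist_fock x y = norm (x - y)"
definition uniformity_fock :: "('a fock \<times> 'a fock) filter" where
  "uniformity_fock = (INF e\<in>{0<..}. principal {(x, y). dist x y < e})"
definition open_fock :: "'a fock set \<Rightarrow> bool" where
  "open_fock U \<longleftrightarrow> (\<forall>x\<in>U. \<forall>\<^sub>F (x', y) in uniformity. x' = x \<longrightarrow> y \<in> U)"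

instance
proof
  fix x y z :: "'a fock" and r :: real
  show "inner x y = inner y x"
  proof -
    have "fock_inner x y = cnj (fock_inner y x)"
      unfolding fock_inner_def infsum_cnj[symmetric] by (simp add: mult.commute)
    then show ?thesis by (simp add: inner_fock_def)
  qed
  show "inner (x + y) z = inner x z + inner y z"
  proof -
    have "fock_inner (x + y) z = fock_inner x z + fock_inner y z"
      unfolding fock_inner_def plus_fock.rep_eq
      by (subst infsum_add[symmetric]) (auto simp: fock_inner_summable algebra_simps)
    then show ?thesis by (simp add: inner_fock_def)
  qed
  show "inner (r *\<^sub>R x) y = r * inner x y"
  proof -
    have "fock_inner (r *\<^sub>R x) y = of_real r * fock_inner x y"
      unfolding fock_inner_def scaleR_fock.rep_eq
      by (subst infsum_cmult_right[symmetric]) 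
        (auto simp: fock_inner_summable scaleR_conv_of_real mult.assoc)
    then show ?thesis by (simp add: inner_fock_def)
  qed
  show "0 \<le> inner x x"
    by (simp add: inner_fock_def fock_inner_self infsum_nonneg)
  show "(inner x x = 0) = (x = 0)"
  proof
    assume "inner x x = 0"
    then have 0: "(\<Sum>\<^sub>\<infinity>w. (cmod (coord x w))\<^sup>2) = 0"
      by (simp add: inner_fock_def fock_inner_self)
    have "(cmod (coord x w))\<^sup>2 = 0" for w
      using nonneg_infsum_le_0D[of "\<lambda>w. (cmod (coord x w))\<^sup>2" UNIV w] 0 coord_summable[of x]
      by simp
    then show "x = 0"
      by (intro iffD1[OF coord_inject]) (simp add: fun_eq_iff zero_fock.rep_eq)
  next
    assume "x = 0"
    then show "inner x x = 0"
      by (simp add: inner_fock_def fock_inner_def zero_fock.rep_eq)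
  qed
qed (simp_all only: norm_fock_def sgn_fock_def dist_fock_def uniformity_fock_def open_fock_def)

end

lemma norm_fock_eq: "norm (x :: 'n fock) = sqrt (\<Sum>\<^sub>\<infinity>w. (cmod (coord x w))\<^sup>2)"
  by (simp add: norm_fock_def inner_fock_def fock_inner_self)

lemma norm_fock_sq: "(norm (x :: 'n fock))\<^sup>2 = (\<Sum>\<^sub>\<infinity>w. (cmod (coord x w))\<^sup>2)"
  by (simp add: norm_fock_eq infsum_nonneg)

lemma norm_fock_scale: "norm (c \<cdot>\<^sub>F x) = cmod c * norm x"
  by (simp add: norm_fock_eq fock_scale.rep_eq norm_mult power_mult_distrib
      infsum_cmult_right' real_sqrt_mult)

lemma sum_le_norm_fock:
  assumes "finite F"
  shows "(\<Sum>w\<in>F. (cmod (coord x w))\<^sup>2) \<le> (norm x)\<^sup>2"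
  unfolding norm_fock_sq
  by (rule finite_sum_le_infsum) (use assms coord_summable in auto)

instance fock :: (type) banach
proof
  fix X :: "nat \<Rightarrow> 'a fock"
  assume X: "Cauchy X"
  have coord_le: "cmod (coord x w) \<le> norm x" for x :: "'a fock" and w
    using sum_le_norm_fock[of "{w}" x] by (intro power2_le_imp_le[OF _ norm_ge_zero]) simp
  have "Cauchy (\<lambda>n. coord (X n) w)" for w
  proof (rule metric_CauchyI)
    fix e :: real assume "e > 0"
    then obtain M where "\<forall>m\<ge>M. \<forall>n\<ge>M. dist (X m) (X n) < e"
      using metric_CauchyD[OF X] by blast
    moreover have "dist (coord (X m) w) (coord (X n) w) \<le> dist (X m) (X n)" for m n
      using coord_le[of "X m - X n" w] by (simp add: dist_norm minus_fock.rep_eq)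
    ultimately show "\<exists>M. \<forall>m\<ge>M. \<forall>n\<ge>M. dist (coord (X m) w) (coord (X n) w) < e"
      by (meson le_less_trans)
  qed
  then have "\<exists>l. (\<lambda>n. coord (X n) w) \<longlonglongrightarrow> l" for w
    using Cauchy_convergent_iff convergent_def by blast
  then obtain l where l: "\<And>w. (\<lambda>n. coord (X n) w) \<longlonglongrightarrow> l w"
    by metis
  have bound: "(\<Sum>w\<in>F. (cmod (coord (X m) w - l w))\<^sup>2) \<le> e\<^sup>2"
    if "finite F" "m \<ge> M" "\<forall>m\<ge>M. \<forall>n\<ge>M. dist (X m) (X n) < e" for F m M e
  proof (rule tendsto_upperbound)
    show "(\<lambda>n. \<Sum>w\<in>F. (cmod (coord (X m) w - coord (X n) w))\<^sup>2)
        \<longlonglongrightarrow> (\<Sum>w\<in>F. (cmod (coord (X m) w - l w))\<^sup>2)"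
      by (intro tendsto_intros l)
    show "\<forall>\<^sub>F n in sequentially. (\<Sum>w\<in>F. (cmod (coord (X m) w - coord (X n) w))\<^sup>2) \<le> e\<^sup>2"
      using eventually_ge_at_top[of M]
    proof eventually_elim
      case (elim n)
      then have "norm (X m - X n) < e"
        using that by (simp add: dist_norm)
      then have "(norm (X m - X n))\<^sup>2 \<le> e\<^sup>2"
        by (intro power_mono) auto
      then show ?case
        using sum_le_norm_fock[OF \<open>finite F\<close>, of "X m - X n"] by (simp add: minus_fock.rep_eq)
    qed
  qed simp
  have summ: "(\<lambda>w. (cmod (coord (X m) w - l w))\<^sup>2) summable_on UNIV"
    if "m \<ge> M" "\<forall>m\<ge>M. \<forall>n\<ge>M. dist (X m) (X n) < e" for m M e
    by (rule nonneg_bdd_above_summable_on) (use bound that in \<open>auto intro!: bdd_aboveI2\<close>)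
  obtain M1 where M1: "\<forall>m\<ge>M1. \<forall>n\<ge>M1. dist (X m) (X n) < 1"
    using metric_CauchyD[OF X, of 1] by auto
  have "(\<lambda>w. (cmod (l w))\<^sup>2) summable_on UNIV"
    using square_summable_add[OF coord_summable[of "X M1"]
        square_summable_cmult[OF summ[OF order.refl M1], of "-1"]] by simp
  then have L: "coord (Abs_fock l) = l"
    by (simp add: Abs_fock_inverse)
  have "X \<longlonglongrightarrow> Abs_fock l"
  proof (rule metric_LIMSEQ_I)
    fix e :: real assume "e > 0"
    then obtain M where M: "\<forall>m\<ge>M. \<forall>n\<ge>M. dist (X m) (X n) < e / 2"
      using metric_CauchyD[OF X, of "e / 2"] by auto
    have "dist (X m) (Abs_fock l) < e" if "m \<ge> M" for m
    proof -
      have "(norm (X m - Abs_fock l))\<^sup>2 \<le> (e / 2)\<^sup>2"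
        unfolding norm_fock_sq minus_fock.rep_eq L
        by (rule infsum_le_finite_sums) (use summ[OF that M] bound[OF _ that M] in auto)
      then have "norm (X m - Abs_fock l) \<le> e / 2"
        by (rule power2_le_imp_le) (use \<open>e > 0\<close> in simp)
      then show ?thesis using \<open>e > 0\<close> by (simp add: dist_norm)
    qed
    then show "\<exists>M. \<forall>m\<ge>M. dist (X m) (Abs_fock l) < e" by blast
  qed
  then show "convergent X" by (rule convergentI)
qed


section \<open>The noncommutative Hardy algebra\<close>

text \<open>The map \<open>\<xi> \<mapsto> v \<otimes> \<xi>\<close>; in particular it sends the vacuum vector to \<open>v\<close>.\<close>

lift_definition tensor_left :: "complex ^ 'n \<Rightarrow> 'n fock \<Rightarrow> 'n fock"
  is "\<lambda>v x w. case w of [] \<Rightarrow> 0 | i # u \<Rightarrow> v $ i * x u"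
proof -
  fix v :: "complex ^ 'n" and x :: "'n list \<Rightarrow> complex"
  assume x: "(\<lambda>w. (cmod (x w))\<^sup>2) summable_on UNIV"
  let ?f = "\<lambda>w. (cmod (case w of [] \<Rightarrow> 0 | i # u \<Rightarrow> v $ i * x u))\<^sup>2"
  have "?f summable_on (Cons i ` UNIV)" for i
    by (subst summable_on_reindex) (use square_summable_cmult[OF x] in \<open>auto simp: o_def\<close>)
  then have "?f summable_on (\<Union>i\<in>UNIV. Cons i ` UNIV)"
    by (intro summable_on_finite_union_disjoint) auto
  then have "?f summable_on (insert [] (\<Union>i\<in>UNIV. Cons i ` UNIV))"
    by (simp add: summable_on_insert_iff)
  also have "insert [] (\<Union>i\<in>UNIV. Cons i ` UNIV) = (UNIV :: 'n list set)"
  proof (intro equalityI subsetI)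
    fix w :: "'n list"
    show "w \<in> insert [] (\<Union>i\<in>UNIV. Cons i ` UNIV)"
      by (cases w) auto
  qed simp
  finally show "?f summable_on UNIV" .
qed

lemma norm_tensor_left: "norm (tensor_left v x) = norm v * norm x"
proof -
  let ?f = "\<lambda>w. (cmod (coord (tensor_left v x) w))\<^sup>2"
  have "(?f has_sum ((cmod (v $ i))\<^sup>2 * (norm x)\<^sup>2)) (Cons i ` UNIV)" for i
    using has_sum_cmult_right[OF has_sum_infsum[OF coord_summable[of x]], of "(cmod (v $ i))\<^sup>2"]
    by (subst has_sum_reindex)
      (auto simp: o_def tensor_left.rep_eq norm_mult power_mult_distrib norm_fock_sq)
  then have "(?f has_sum (\<Sum>i\<in>UNIV. (cmod (v $ i))\<^sup>2 * (norm x)\<^sup>2)) (\<Union>i\<in>UNIV. Cons i ` UNIV)"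
    by (intro sum_has_sum) auto
  moreover have "(\<Sum>i\<in>UNIV. (cmod (v $ i))\<^sup>2 * (norm x)\<^sup>2) = (norm v * norm x)\<^sup>2"
    by (simp add: norm_vec_def L2_set_def sum_nonneg power_mult_distrib flip: sum_distrib_right)
  moreover have "(?f has_sum s) (\<Union>i\<in>UNIV. Cons i ` UNIV) \<longleftrightarrow> (?f has_sum s) UNIV" for s
    by (rule has_sum_cong_neutral) (auto simp: tensor_left.rep_eq split: list.splits)
  ultimately have "(norm (tensor_left v x))\<^sup>2 = (norm v * norm x)\<^sup>2"
    unfolding norm_fock_sq by (metis infsumI)
  then show ?thesis by simp
qed

lift_definition creation :: "'n \<Rightarrow> ('n::finite fock \<Rightarrow>\<^sub>L 'n fock)"
  is "\<lambda>j. tensor_left (axis j 1)"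
proof -
  fix j :: 'n
  show "bounded_linear (tensor_left (axis j 1 :: complex ^ 'n))"
  proof (rule bounded_linear_intro[where K = 1])
    fix x y :: "'n fock" and r :: real
    show "tensor_left (axis j 1) (x + y) = tensor_left (axis j 1) x + tensor_left (axis j 1) y"
      by transfer (auto simp: fun_eq_iff algebra_simps split: list.splits)
    show "tensor_left (axis j 1) (r *\<^sub>R x) = r *\<^sub>R tensor_left (axis j 1) x"
      by transfer (auto simp: fun_eq_iff split: list.splits)
    show "norm (tensor_left (axis j 1) x) \<le> norm x * 1"
      by (simp add: norm_tensor_left)
  qed
qed

definition op_scale :: "complex \<Rightarrow> ('n fock \<Rightarrow>\<^sub>L 'n fock) \<Rightarrow> ('n fock \<Rightarrow>\<^sub>L 'n fock)" where
  "op_scale c T = Blinfun (\<lambda>x. c \<cdot>\<^sub>F blinfun_apply T x)"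

lemma bounded_linear_fock_scale: "bounded_linear (\<lambda>x :: 'n fock. c \<cdot>\<^sub>F x)"
proof (rule bounded_linear_intro[where K = "cmod c"])
  fix x y :: "'n fock" and r :: real
  show "c \<cdot>\<^sub>F (x + y) = c \<cdot>\<^sub>F x + c \<cdot>\<^sub>F y"
    by transfer (simp add: algebra_simps)
  show "c \<cdot>\<^sub>F (r *\<^sub>R x) = r *\<^sub>R (c \<cdot>\<^sub>F x)"
    by transfer (simp add: algebra_simps)
  show "norm (c \<cdot>\<^sub>F x) \<le> norm x * cmod c"
    by (simp add: norm_fock_scale)
qed

lemma op_scale_apply: "blinfun_apply (op_scale c T) x = c \<cdot>\<^sub>F blinfun_apply T x"
  unfolding op_scale_def
  by (simp add: bounded_linear_Blinfun_apply
      bounded_linear_compose[OF bounded_linear_fock_scale blinfun.bounded_linear_right])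

text \<open>
  The type \<open>'n fock \<Rightarrow>\<^sub>L 'n fock\<close> consists of the bounded \<open>\<real>\<close>-linear operators; the bounded operators
  of the complex Hilbert space are the following ones.
\<close>

definition bounded_operators :: "('n fock \<Rightarrow>\<^sub>L 'n fock) set" where
  "bounded_operators = {T. \<forall>c x. blinfun_apply T (c \<cdot>\<^sub>F x) = c \<cdot>\<^sub>F blinfun_apply T x}"

definition weak_operator_topology :: "('n fock \<Rightarrow>\<^sub>L 'n fock) topology" where
  "weak_operator_topology = topology_generated_by
     {{T \<in> bounded_operators. fock_inner (blinfun_apply T x) y \<in> U} | x y U. open U}"

inductive_set creation_algebra :: "('n::finite fock \<Rightarrow>\<^sub>L 'n fock) set" where
  one: "id_blinfun \<in> creation_algebra"
| creation: "creation j \<in> creation_algebra"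
| add: "S \<in> creation_algebra \<Longrightarrow> T \<in> creation_algebra \<Longrightarrow> S + T \<in> creation_algebra"
| scale: "T \<in> creation_algebra \<Longrightarrow> op_scale c T \<in> creation_algebra"
| mult: "S \<in> creation_algebra \<Longrightarrow> T \<in> creation_algebra \<Longrightarrow> S o\<^sub>L T \<in> creation_algebra"

definition hardy_algebra :: "('n::finite fock \<Rightarrow>\<^sub>L 'n fock) set" where
  "hardy_algebra = weak_operator_topology closure_of creation_algebra"

text \<open>
  The weak* topology of the Hardy algebra is the restriction of the weak operator topology.  The
  requirement \<open>\<pi> \<in> extensional hardy_algebra\<close> only fixes the irrelevant values of \<open>\<pi>\<close> outside the
  Hardy algebra, so that uniqueness of the character makes sense for a total function.
\<close>

definition point_character ::
  "complex ^ 'n \<Rightarrow> (('n::finite fock \<Rightarrow>\<^sub>L 'n fock) \<Rightarrow> complex) \<Rightarrow> bool" where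
  "point_character l \<pi> \<longleftrightarrow>
     \<pi> \<in> extensional hardy_algebra \<and>
     (\<forall>S\<in>hardy_algebra. \<forall>T\<in>hardy_algebra. \<pi> (S + T) = \<pi> S + \<pi> T) \<and>
     (\<forall>c. \<forall>T\<in>hardy_algebra. \<pi> (op_scale c T) = c * \<pi> T) \<and>
     (\<forall>S\<in>hardy_algebra. \<forall>T\<in>hardy_algebra. \<pi> (S o\<^sub>L T) = \<pi> S * \<pi> T) \<and>
     \<pi> id_blinfun = 1 \<and>
     continuous_map (subtopology weak_operator_topology hardy_algebra) euclidean \<pi> \<and>
     (\<forall>j. \<pi> (creation j) = l $ j)"

definition hardy_eval :: "('n::finite fock \<Rightarrow>\<^sub>L 'n fock) \<Rightarrow> complex ^ 'n \<Rightarrow> complex" where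
  "hardy_eval \<phi> l = (THE \<pi>. point_character l \<pi>) \<phi>"


section \<open>The pseudohyperbolic distance on the unit ball\<close>

text \<open>The open unit ball of \<open>\<complex>\<^sup>n\<close> is \<open>ball 0 1\<close>: the norm of \<open>complex ^ 'n\<close> is the Euclidean one.\<close>

text \<open>Holomorphy in several variables, as Frechet differentiability with \<open>\<complex>\<close>-linear derivative; used
  for open sets only.\<close>

definition holomorphic_map_on ::
  "(complex ^ 'n \<Rightarrow> complex ^ 'm) \<Rightarrow> (complex ^ 'n) set \<Rightarrow> bool" where
  "holomorphic_map_on f U \<longleftrightarrow>
     (\<forall>x\<in>U. \<exists>D. (f has_derivative D) (at x) \<and> (\<forall>c v. D (c *s v) = c *s D v))"

definition biholomorphic_map ::
  "(complex ^ 'n) set \<Rightarrow> (complex ^ 'm) set \<Rightarrow> (complex ^ 'n \<Rightarrow> complex ^ 'm) \<Rightarrow> bool" where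
  "biholomorphic_map U V \<psi> \<longleftrightarrow>
     bij_betw \<psi> U V \<and> holomorphic_map_on \<psi> U \<and> holomorphic_map_on (inv_into U \<psi>) V"

definition pseudohyperbolic_dist :: "complex ^ 'n \<Rightarrow> complex ^ 'n \<Rightarrow> real" where
  "pseudohyperbolic_dist z w =
     (THE d. \<exists>\<psi> :: complex ^ 'n \<Rightarrow> complex ^ 'n.
        biholomorphic_map (ball 0 1) (ball 0 1) \<psi> \<and> \<psi> z = 0 \<and> d = dist 0 (\<psi> w))"

end

theory Submission
  imports Defs "HOL-Complex_Analysis.Conformal_Mappings"
begin

text \<open>
  Both sides are computed and compared.  On the geometric side, the Moebius map \<open>mobius z\<close>, an
  explicit involution of the ball interchanging \<open>0\<close> and \<open>z\<close>, witnesses the pseudohyperbolic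
  distance; by the Schwarz lemma on complex lines, two biholomorphic self-maps of the ball sending
  \<open>z\<close> to \<open>0\<close> move every \<open>w\<close> equally far from \<open>0\<close>.  Hence the distance is the norm of
  \<open>mobius z w\<close> (\<open>pseudohyperbolic_dist_eq\<close>), and \<open>norm_mobius\<close> gives
  \<open>1 - \<rho>(z,w)\<^sup>2 = (1 - |z|\<^sup>2) (1 - |w|\<^sup>2) / |1 - \<langle>w,z\<rangle>|\<^sup>2\<close>.

  On the operator side, for each point \<open>l\<close> of the ball the Fock space contains a vector \<open>szego l\<close>, with
  coordinates \<open>cnj (l i\<^sub>1 \<dots> l i\<^sub>k)\<close>, that is a joint eigenvector of the adjoints of the creation
  operators, hence of the adjoints of all elements of the Hardy algebra:
  \<open>\<langle>T x, szego l\<rangle> = \<langle>x, szego l\<rangle> \<langle>T 1, szego l\<rangle>\<close> (\<open>hardy_szego\<close>).  So evaluation at \<open>l\<close> is the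
  functional \<open>T \<mapsto> \<langle>T 1, szego l\<rangle>\<close>, which is multiplicative and weak operator continuous, and a
  density argument shows that it is the only continuous character with the prescribed values
  (\<open>hardy_eval_eq\<close>).

  Upper bound (\<open>hardy_eval_le_mobius\<close>): if \<open>\<phi>\<close> vanishes at \<open>w\<close>, then the range of \<open>\<phi>\<close> is orthogonal to
  \<open>szego w\<close>, so only the component of \<open>szego z\<close> orthogonal to \<open>szego w\<close> contributes to
  \<open>\<phi>(z) |szego z|\<^sup>2 = \<langle>\<phi> (szego z), szego z\<rangle>\<close>.  The sine of the angle between the two
  kernel vectors is exactly \<open>\<rho>(z,w)\<close>, because \<open>\<langle>szego z, szego w\<rangle> = 1 / (1 - \<langle>w,z\<rangle>)\<close>.

  Attainment (\<open>extremal_operator\<close>): the Moebius map \<open>mobius w\<close> has a noncommutative lift, a row of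
  isometries with orthogonal ranges in the Hardy algebra.  Pairing this row with a unit vector \<open>u\<close>
  in the direction of \<open>mobius w z\<close> gives an isometry whose value at \<open>l\<close> is \<open>\<langle>mobius w l, u\<rangle>\<close>:
  it is \<open>0\<close> at \<open>w\<close> and \<open>|mobius w z| = \<rho>(z,w)\<close> at \<open>z\<close>.
\<close>

section \<open>The Hermitian product of complex coordinate space\<close>

definition herm :: "complex ^ 'n \<Rightarrow> complex ^ 'n \<Rightarrow> complex" where
  "herm u v = (\<Sum>i\<in>UNIV. u $ i * cnj (v $ i))"

lemma herm_add_left: "herm (u + v) w = herm u w + herm v w"
  and herm_diff_left: "herm (u - v) w = herm u w - herm v w"
  and herm_scale_left: "herm (c *s u) w = c * herm u w"
  and herm_scale_right: "herm u (c *s w) = cnj c * herm u w"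
  and herm_add_right: "herm w (u + v) = herm w u + herm w v"
  and herm_diff_right: "herm w (u - v) = herm w u - herm w v"
  by (simp_all add: herm_def algebra_simps sum.distrib sum_subtractf sum_distrib_left)

lemma herm_zero [simp]: "herm 0 v = 0" "herm v 0 = 0"
  by (simp_all add: herm_def)

lemma cnj_herm: "cnj (herm u v) = herm v u"
  by (simp add: herm_def mult.commute)

lemma herm_self: "herm u u = of_real ((norm u)\<^sup>2)"
  by (simp add: herm_def norm_vec_def L2_set_def sum_nonneg complex_norm_square[symmetric])

lemma Re_herm: "Re (herm u v) = inner u v"
  by (simp add: herm_def inner_vec_def inner_complex_def)

lemma norm_cscale: "norm (c *s (u :: complex ^ 'n)) = cmod c * norm u"
proof -
  have "herm (c *s u) (c *s u) = (c * cnj c) * herm u u"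
    by (simp add: herm_scale_left herm_scale_right)
  also have "\<dots> = of_real ((cmod c)\<^sup>2) * of_real ((norm u)\<^sup>2)"
    by (simp only: herm_self complex_norm_square)
  finally have "complex_of_real ((norm (c *s u))\<^sup>2) = of_real ((cmod c * norm u)\<^sup>2)"
    by (simp add: herm_self power_mult_distrib)
  then show ?thesis
    by (metis norm_ge_zero of_real_eq_iff power2_eq_iff_nonneg mult_nonneg_nonneg)
qed

text \<open>
  The complex Cauchy--Schwarz inequality follows from the real one for \<open>Re (herm u v)\<close> by rotating
  \<open>v\<close> by the phase of \<open>herm u v\<close>.
\<close>

lemma norm_herm_le: "cmod (herm u v) \<le> norm u * norm v"
proof -
  have "(cmod (herm u v))\<^sup>2 = Re (herm u (herm u v *s v))"
    unfolding herm_scale_right by (simp add: cmod_power2) (simp add: power2_eq_square)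
  also have "\<dots> \<le> norm u * (cmod (herm u v) * norm v)"
    unfolding Re_herm using norm_cauchy_schwarz[of u "herm u v *s v"] by (simp add: norm_cscale)
  finally have "cmod (herm u v) * cmod (herm u v) \<le> cmod (herm u v) * (norm u * norm v)"
    by (simp add: power2_eq_square mult_ac)
  then show ?thesis
    by (cases "herm u v = 0") (auto simp: mult_le_cancel_left)
qed

lemma norm_diff_squared_herm:
  "(norm (u - v))\<^sup>2 = (norm u)\<^sup>2 - 2 * Re (herm u v) + (norm v)\<^sup>2"
  by (simp add: Re_herm power2_norm_eq_inner inner_diff_left inner_diff_right inner_commute)

lemma herm_neq_one:
  assumes "norm u < 1" "norm v < 1"
  shows "herm u v \<noteq> 1"
proof
  assume "herm u v = 1"
  then have "1 \<le> norm u * norm v"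
    using norm_herm_le[of u v] by simp
  moreover have "norm u * norm v < 1"
    using mult_strict_mono'[OF assms] by simp
  ultimately show False by simp
qed

lemma bounded_bilinear_cscale:
  "bounded_bilinear (\<lambda>(c :: complex) (v :: complex ^ 'n). c *s v)"
proof
  show "\<exists>K. \<forall>a b. norm (a *s (b :: complex ^ 'n)) \<le> norm a * norm b * K"
    by (rule exI[of _ 1]) (simp add: norm_cscale)
qed (auto simp: vec_eq_iff algebra_simps)

lemma bounded_linear_herm: "bounded_linear (\<lambda>u. herm u v)"
proof (rule bounded_linear_intro[where K = "norm v"])
  fix u :: "complex ^ 'a" and r :: real
  show "herm (r *\<^sub>R u) v = r *\<^sub>R herm u v"
    by (simp add: herm_def scaleR_sum_right)
qed (simp_all add: herm_add_left norm_herm_le)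


section \<open>Moebius involutions of the ball\<close>

definition defect :: "complex ^ 'n \<Rightarrow> real" where
  "defect a = sqrt (1 - (norm a)\<^sup>2)"

lemma defect_pos: "norm a < 1 \<Longrightarrow> defect a > 0"
  and defect_sq: "norm a < 1 \<Longrightarrow> (defect a)\<^sup>2 = 1 - (norm a)\<^sup>2"
proof -
  assume "norm a < 1"
  then have "(norm a)\<^sup>2 < 1"
    by (simp add: power_less_one_iff)
  then show "defect a > 0" "(defect a)\<^sup>2 = 1 - (norm a)\<^sup>2"
    by (simp_all add: defect_def)
qed

lemma one_plus_defect_neq_zero: "norm a < 1 \<Longrightarrow> 1 + complex_of_real (defect a) \<noteq> 0"
  using defect_pos[of a] by (metis add_pos_pos zero_less_one of_real_1 of_real_add of_real_eq_0_iff order_less_irrefl)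

lemma herm_self_defect:
  assumes "norm a < 1"
  shows "herm a a = (1 - of_real (defect a)) * (1 + of_real (defect a))"
  using defect_sq[OF assms]
  by (simp add: herm_self algebra_simps flip: power2_eq_square)
    (metis of_real_1 of_real_add of_real_power add.commute diff_add_cancel)

text \<open>
  The Moebius map exchanging \<open>0\<close> and \<open>a\<close> is usually written \<open>l \<mapsto> (a - P l - s Q l) / (1 - \<langle>l,a\<rangle>)\<close>, where \<open>P\<close> is the
  orthogonal projection onto the line of \<open>a\<close>, \<open>Q = 1 - P\<close> and \<open>s\<close> is the defect.  Since
  \<open>|a|\<^sup>2 = (1 - s) (1 + s)\<close>, one has \<open>P l + s Q l = s l + (\<langle>l,a\<rangle> / (1 + s)) a\<close>, a form that needs no
  division by \<open>|a|\<close> and so makes sense for \<open>a = 0\<close>.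
\<close>

definition mobius :: "complex ^ 'n \<Rightarrow> complex ^ 'n \<Rightarrow> complex ^ 'n" where
  "mobius a l = (1 / (1 - herm l a)) *s
     (a - of_real (defect a) *s l - (herm l a / (1 + of_real (defect a))) *s a)"

lemma mobius_nth:
  "mobius a l $ i = (1 / (1 - herm l a)) *
     (a $ i - of_real (defect a) * l $ i - (herm l a / (1 + of_real (defect a))) * a $ i)"
  by (simp only: mobius_def vector_smult_component vector_minus_component)

lemma mobius_self:
  assumes "norm a < 1"
  shows "mobius a a = 0"
proof -
  have "herm a a / (1 + of_real (defect a)) = 1 - of_real (defect a)"
    using one_plus_defect_neq_zero[OF assms] by (simp add: herm_self_defect[OF assms])
  then have "mobius a a = (1 / (1 - herm a a)) *s
      (a - of_real (defect a) *s a - (1 - of_real (defect a)) *s a)"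
    by (simp only: mobius_def)
  also have "a - of_real (defect a) *s a - (1 - of_real (defect a)) *s a = 0"
    by (simp add: vec_eq_iff algebra_simps)
  finally show ?thesis
    by simp
qed

text \<open>
  The denominator of the second application of the Moebius map in the proof that it is an
  involution.
\<close>

lemma herm_mobius:
  assumes "norm a < 1" "norm l < 1"
  shows "1 - herm (mobius a l) a = (of_real (defect a))\<^sup>2 / (1 - herm l a)"
proof -
  define s where "s = complex_of_real (defect a)"
  define t where "t = herm l a"
  have s: "1 + s \<noteq> 0" and t: "1 - t \<noteq> 0"
    using one_plus_defect_neq_zero[OF assms(1)] herm_neq_one[OF assms(2,1)] by (auto simp: s_def t_def)
  have "herm (mobius a l) a = (1 / (1 - t)) * ((1 - s) * (1 + s) - s * t - t / (1 + s) * ((1 - s) * (1 + s)))"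
    by (simp add: mobius_def herm_diff_left herm_scale_left herm_self_defect[OF assms(1)] s_def t_def diff_divide_distrib)
  also have "t / (1 + s) * ((1 - s) * (1 + s)) = t * (1 - s)"
    using s by simp
  finally have "herm (mobius a l) a = (1 / (1 - t)) * ((1 - s) * (1 + s) - s * t - t * (1 - s))" .
  then have "1 - herm (mobius a l) a = s\<^sup>2 / (1 - t)"
    using t by (simp add: field_simps power2_eq_square)
  then show ?thesis
    by (simp add: s_def t_def)
qed

lemma mobius_involution:
  assumes "norm a < 1" "norm l < 1"
  shows "mobius a (mobius a l) = l"
proof -
  define s where "s = complex_of_real (defect a)"
  define t where "t = herm l a"
  define m where "m = mobius a l"
  have s: "1 + s \<noteq> 0" "s \<noteq> 0" and t: "1 - t \<noteq> 0"
    using one_plus_defect_neq_zero[OF assms(1)] herm_neq_one[OF assms(2,1)] defect_pos[OF assms(1)]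
    by (auto simp: s_def t_def)
  have h: "1 - herm m a = s\<^sup>2 / (1 - t)"
    using herm_mobius[OF assms] by (simp add: s_def t_def m_def)
  then have h': "herm m a = 1 - s\<^sup>2 / (1 - t)"
    by (simp add: algebra_simps)
  have "mobius a m $ i = l $ i" for i
  proof -
    have m: "m $ i = (1 / (1 - t)) * (a $ i - s * l $ i - (t / (1 + s)) * a $ i)"
      by (simp only: m_def mobius_nth s_def t_def)
    have "mobius a m $ i = ((1 - t) / s\<^sup>2) * (a $ i - s * m $ i - ((1 - s\<^sup>2 / (1 - t)) / (1 + s)) * a $ i)"
      unfolding mobius_nth s_def[symmetric] h h' by simp
    also have "\<dots> = l $ i"
      unfolding m using s t by (simp add: divide_simps) (algebra)
    finally show ?thesis .
  qed
  then show ?thesis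
    by (simp add: vec_eq_iff m_def)
qed

text \<open>
  The numerator is \<open>a - L\<close>, where \<open>L\<close> is the image of \<open>l\<close> under the map that is the identity along
  \<open>a\<close> and \<open>s\<close> on its complement.  This gives \<open>\<langle>L,a\<rangle> = \<langle>l,a\<rangle>\<close> and \<open>|L|\<^sup>2 = s\<^sup>2 |l|\<^sup>2 + |\<langle>l,a\<rangle>|\<^sup>2\<close>; expanding
  \<open>|1 - \<langle>l,a\<rangle>|\<^sup>2 - |a - L|\<^sup>2\<close> then leaves only \<open>s\<^sup>2 (1 - |l|\<^sup>2)\<close>.
\<close>

lemma norm_mobius:
  assumes "norm a < 1" "norm l < 1"
  shows "1 - (norm (mobius a l))\<^sup>2 =
    (1 - (norm a)\<^sup>2) * (1 - (norm l)\<^sup>2) / (cmod (1 - herm l a))\<^sup>2"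
proof -
  define s where "s = defect a"
  define t where "t = herm l a"
  define L where "L = of_real s *s l + (t / (1 + of_real s)) *s a"
  have s: "1 + complex_of_real s \<noteq> 0" and t: "1 - t \<noteq> 0" and s2: "s\<^sup>2 = 1 - (norm a)\<^sup>2"
    using one_plus_defect_neq_zero[OF assms(1)] herm_neq_one[OF assms(2,1)] defect_sq[OF assms(1)]
    by (auto simp: s_def t_def)
  have cn: "herm a l = cnj t"
    by (simp add: t_def cnj_herm)
  have La: "herm L a = t"
    using s by (simp add: L_def herm_add_left herm_scale_left herm_self_defect[OF assms(1)] flip: s_def t_def)
      (simp add: algebra_simps)
  have "herm L L = of_real s * herm l L + t / (1 + of_real s) * herm a L"
    by (simp add: L_def herm_add_left herm_scale_left)
  also have "herm a L = cnj t"
    using La by (metis cnj_herm)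
  also have "herm l L = of_real s * herm l l + t * cnj t / (1 + of_real s)"
    by (simp add: L_def herm_add_right herm_scale_right flip: t_def)
  also have "of_real s * (of_real s * herm l l + t * cnj t / (1 + of_real s)) + t / (1 + of_real s) * cnj t
      = of_real (s\<^sup>2) * herm l l + t * cnj t"
    using s by (simp add: divide_simps) (simp add: algebra_simps power2_eq_square)
  finally have "complex_of_real ((norm L)\<^sup>2) = of_real (s\<^sup>2 * (norm l)\<^sup>2 + (cmod t)\<^sup>2)"
    by (simp add: herm_self flip: complex_norm_square)
  then have L: "(norm L)\<^sup>2 = s\<^sup>2 * (norm l)\<^sup>2 + (cmod t)\<^sup>2"
    using of_real_eq_iff by blast
  have "herm a L = cnj t"
    using La by (metis cnj_herm)
  then have "(norm (a - L))\<^sup>2 = (norm a)\<^sup>2 - 2 * Re t + s\<^sup>2 * (norm l)\<^sup>2 + (cmod t)\<^sup>2"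
    by (simp add: norm_diff_squared_herm L)
  moreover have "(cmod (1 - t))\<^sup>2 = 1 - 2 * Re t + (cmod t)\<^sup>2"
    unfolding cmod_power2 by (simp add: power2_eq_square algebra_simps)
  ultimately have "(cmod (1 - t))\<^sup>2 - (norm (a - L))\<^sup>2 = (1 - (norm a)\<^sup>2) * (1 - (norm l)\<^sup>2)"
    using s2 by (simp add: algebra_simps)
  moreover have "mobius a l = (1 / (1 - t)) *s (a - L)"
    by (simp add: mobius_def L_def s_def t_def algebra_simps)
  then have "(norm (mobius a l))\<^sup>2 = (norm (a - L))\<^sup>2 / (cmod (1 - t))\<^sup>2"
    by (simp only: norm_cscale) (simp add: norm_divide power_divide)
  then have "1 - (norm (mobius a l))\<^sup>2 = ((cmod (1 - t))\<^sup>2 - (norm (a - L))\<^sup>2) / (cmod (1 - t))\<^sup>2"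
    using t by (simp add: field_simps)
  ultimately show ?thesis
    by (simp add: t_def)
qed

lemma norm_mobius_less_one:
  assumes "norm a < 1" "norm l < 1"
  shows "norm (mobius a l) < 1"
proof -
  have "0 < 1 - (norm (mobius a l))\<^sup>2"
    unfolding norm_mobius[OF assms] using assms herm_neq_one[OF assms(2,1)]
    by (intro divide_pos_pos mult_pos_pos) (auto simp: power_less_one_iff)
  then show ?thesis
    by (simp add: power_less_one_iff)
qed

lemma mobius_holomorphic:
  assumes "norm a < 1"
  shows "holomorphic_map_on (mobius a) (ball 0 1)"
  unfolding holomorphic_map_on_def
proof
  fix x :: "complex ^ 'a"
  assume "x \<in> ball 0 1"
  then have t: "herm x a \<noteq> 1"
    using herm_neq_one[of x a] assms by simp
  define s k where "s = complex_of_real (defect a)" and "k = 1 / (1 + s)"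
  define N where "N = (\<lambda>x. a - s *s x - (herm x a * k) *s a)"
  define N' where "N' = (\<lambda>v. - (s *s v) - (herm v a * k) *s a)"
  define D where "D = (\<lambda>v. (1 / (1 - herm x a)) *s N' v + (1 / (1 - herm x a)\<^sup>2 * herm v a) *s N x)"
  note herm' = bounded_linear_imp_has_derivative[OF bounded_linear_herm]
  note cscale' = bounded_linear.has_derivative[OF bounded_bilinear.bounded_linear_right[OF bounded_bilinear_cscale]]
    bounded_linear.has_derivative[OF bounded_bilinear.bounded_linear_left[OF bounded_bilinear_cscale]]
  have "(N has_derivative N') (at x)"
    unfolding N_def N'_def by (auto intro!: derivative_eq_intros herm' cscale')
  moreover have "((\<lambda>t. 1 / (1 - t)) has_field_derivative 1 / (1 - herm x a)\<^sup>2) (at (herm x a))"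
    using t by (auto intro!: derivative_eq_intros simp: power2_eq_square)
  then have "((\<lambda>x. 1 / (1 - herm x a)) has_derivative (\<lambda>v. 1 / (1 - herm x a)\<^sup>2 * herm v a)) (at x)"
    unfolding has_field_derivative_def by (rule has_derivative_compose[OF herm'])
  ultimately have "((\<lambda>x. (1 / (1 - herm x a)) *s N x) has_derivative D) (at x)"
    unfolding D_def by (intro bounded_bilinear.FDERIV[OF bounded_bilinear_cscale])
  moreover have "(\<lambda>x. (1 / (1 - herm x a)) *s N x) = mobius a"
    by (simp add: fun_eq_iff mobius_def N_def s_def k_def)
  moreover have "D (c *s v) = c *s D v" for c v
    by (simp add: D_def N'_def vec_eq_iff herm_scale_left algebra_simps)
  ultimately show "\<exists>D. (mobius a has_derivative D) (at x) \<and> (\<forall>c v. D (c *s v) = c *s D v)"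
    by auto
qed

lemma mobius_biholomorphic:
  assumes "norm a < 1"
  shows "biholomorphic_map (ball 0 1) (ball 0 1) (mobius a)"
proof -
  have bij: "bij_betw (mobius a) (ball 0 1) (ball 0 1)"
    by (rule bij_betw_byWitness[where f' = "mobius a"])
      (use assms norm_mobius_less_one[OF assms] mobius_involution[OF assms] in auto)
  have inv: "inv_into (ball 0 1) (mobius a) y = mobius a y" if "y \<in> ball 0 1" for y
    using that bij assms norm_mobius_less_one[OF assms] mobius_involution[OF assms]
    by (intro inv_into_f_eq) (auto simp: bij_betw_def)
  have "holomorphic_map_on (inv_into (ball 0 1) (mobius a)) (ball 0 1)"
    unfolding holomorphic_map_on_def
  proof
    fix x :: "complex ^ 'a"
    assume x: "x \<in> ball 0 1"
    with mobius_holomorphic[OF assms] obtain D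
      where D: "(mobius a has_derivative D) (at x)" "\<forall>c v. D (c *s v) = c *s D v"
      unfolding holomorphic_map_on_def by blast
    have "(inv_into (ball 0 1) (mobius a) has_derivative D) (at x)"
      by (rule has_derivative_transform_within_open[OF D(1) open_ball x]) (simp add: inv)
    with D(2) show "\<exists>D. (inv_into (ball 0 1) (mobius a) has_derivative D) (at x) \<and> (\<forall>c v. D (c *s v) = c *s D v)"
      by blast
  qed
  then show ?thesis
    using bij mobius_holomorphic[OF assms] by (simp add: biholomorphic_map_def)
qed

section \<open>The Schwarz lemma and the pseudohyperbolic distance\<close>

text \<open>
  Apply the Schwarz lemma of one variable to \<open>f\<close> restricted to the complex line through \<open>x\<close> and
  projected orthogonally onto the line through \<open>f x\<close>.
\<close>

lemma Schwarz_ball: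
  fixes f :: "complex ^ 'n \<Rightarrow> complex ^ 'm"
  assumes f: "holomorphic_map_on f (ball 0 1)" and maps: "f ` ball 0 1 \<subseteq> ball 0 1" and "f 0 = 0"
    and x: "norm x < 1"
  shows "norm (f x) \<le> norm x"
proof (cases "x = 0 \<or> f x = 0")
  case True
  then show ?thesis
    using \<open>f 0 = 0\<close> by auto
next
  case False
  define e where "e = inverse (of_real (norm x)) *s x"
  define y where "y = inverse (of_real (norm (f x))) *s f x"
  define h where "h = (\<lambda>\<zeta>. herm (f (\<zeta> *s e)) y)"
  have e: "norm e = 1" and y: "norm y = 1"
    using False by (simp_all add: e_def y_def norm_cscale norm_inverse)
  have "norm (h (of_real (norm x))) \<le> norm (complex_of_real (norm x))"
  proof (rule Schwarz_Lemma)
    show "h holomorphic_on ball 0 1"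
    proof (rule holomorphic_onI)
      fix \<zeta> :: complex
      assume "\<zeta> \<in> ball 0 1"
      then have "\<zeta> *s e \<in> ball 0 1"
        by (simp add: norm_cscale e)
      with f obtain D where D: "(f has_derivative D) (at (\<zeta> *s e))" "\<forall>c v. D (c *s v) = c *s D v"
        unfolding holomorphic_map_on_def by blast
      have "((\<lambda>\<zeta>. \<zeta> *s e) has_derivative (\<lambda>\<zeta>. \<zeta> *s e)) (at \<zeta>)"
        by (intro bounded_linear_imp_has_derivative
            bounded_bilinear.bounded_linear_left[OF bounded_bilinear_cscale])
      then have "((\<lambda>\<zeta>. f (\<zeta> *s e)) has_derivative (\<lambda>c. D (c *s e))) (at \<zeta>)"
        using D(1) by (rule has_derivative_compose)
      then have "(h has_derivative (\<lambda>c. herm (D (c *s e)) y)) (at \<zeta>)"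
        unfolding h_def by (rule bounded_linear.has_derivative[OF bounded_linear_herm])
      also have "(\<lambda>c. herm (D (c *s e)) y) = (*) (herm (D e) y)"
        by (simp add: D(2) herm_scale_left fun_eq_iff)
      finally have "(h has_field_derivative herm (D e) y) (at \<zeta>)"
        by (simp add: has_field_derivative_def)
      then show "h field_differentiable at \<zeta> within ball 0 1"
        using field_differentiable_at_within field_differentiable_def by blast
    qed
    show "h 0 = 0"
      using \<open>f 0 = 0\<close> by (simp add: h_def)
    show "norm (h \<zeta>) < 1" if "norm \<zeta> < 1" for \<zeta>
    proof -
      have "\<zeta> *s e \<in> ball 0 1"
        using that by (simp add: norm_cscale e)
      then have "norm (f (\<zeta> *s e)) < 1"
        using maps by fastforce
      then show ?thesis
        using norm_herm_le[of "f (\<zeta> *s e)" y] y by (simp add: h_def)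
    qed
  qed (use x in simp)
  moreover have "of_real (norm x) *s e = x"
    using False by (simp add: e_def)
  then have "h (of_real (norm x)) = of_real (norm (f x))"
    using False by (simp add: h_def y_def herm_scale_right herm_self power2_eq_square)
  ultimately show ?thesis
    by simp
qed

text \<open>
  The composition of \<open>\<theta>\<close> with the inverse of \<open>\<psi>\<close> is a holomorphic self-map of the ball fixing the
  origin.  Used in both directions, the inequality makes the pseudohyperbolic distance independent
  of the choice of the biholomorphic map.
\<close>

lemma biholomorphic_fixing_same_norm:
  fixes \<psi> \<theta> :: "complex ^ 'n \<Rightarrow> complex ^ 'n"
  assumes \<psi>: "biholomorphic_map (ball 0 1) (ball 0 1) \<psi>" "\<psi> z = 0"
    and \<theta>: "biholomorphic_map (ball 0 1) (ball 0 1) \<theta>" "\<theta> z = 0"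
    and z: "z \<in> ball 0 1" and w: "w \<in> ball 0 1"
  shows "norm (\<theta> w) \<le> norm (\<psi> w)"
proof -
  define f where "f = \<theta> \<circ> inv_into (ball 0 1) \<psi>"
  have bij: "bij_betw \<psi> (ball 0 1) (ball 0 1)" "bij_betw \<theta> (ball 0 1) (ball 0 1)"
    using \<psi> \<theta> by (auto simp: biholomorphic_map_def)
  have inv: "inv_into (ball 0 1) \<psi> (\<psi> v) = v" if "v \<in> ball 0 1" for v
    using bij(1) that by (simp add: bij_betw_inv_into_left)
  have inv_ball: "inv_into (ball 0 1) \<psi> v \<in> ball 0 1" if "v \<in> ball 0 1" for v
    using bij_betw_apply[OF bij_betw_inv_into[OF bij(1)] that] .
  have "norm (f (\<psi> w)) \<le> norm (\<psi> w)"
  proof (rule Schwarz_ball)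
    show "holomorphic_map_on f (ball 0 1)"
      unfolding holomorphic_map_on_def
    proof
      fix x :: "complex ^ 'n"
      assume x: "x \<in> ball 0 1"
      obtain D where D: "(inv_into (ball 0 1) \<psi> has_derivative D) (at x)" "\<forall>c v. D (c *s v) = c *s D v"
        using \<psi>(1) x unfolding biholomorphic_map_def holomorphic_map_on_def by blast
      obtain E where E: "(\<theta> has_derivative E) (at (inv_into (ball 0 1) \<psi> x))" "\<forall>c v. E (c *s v) = c *s E v"
        using \<theta>(1) inv_ball[OF x] unfolding biholomorphic_map_def holomorphic_map_on_def by blast
      have "(f has_derivative (\<lambda>v. E (D v))) (at x)"
        unfolding f_def o_def by (rule has_derivative_compose[OF D(1) E(1)])
      with D(2) E(2) show "\<exists>D. (f has_derivative D) (at x) \<and> (\<forall>c v. D (c *s v) = c *s D v)"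
        by (intro exI[of _ "\<lambda>v. E (D v)"]) simp
    qed
    show "f ` ball 0 1 \<subseteq> ball 0 1"
      unfolding f_def using inv_ball bij_betw_apply[OF bij(2)] by fastforce
    show "f 0 = 0"
      using inv[OF z] \<psi>(2) \<theta>(2) by (simp add: f_def)
    show "norm (\<psi> w) < 1"
      using bij_betw_apply[OF bij(1) w] by simp
  qed
  then show ?thesis
    using inv[OF w] by (simp add: f_def)
qed

lemma pseudohyperbolic_dist_eq:
  assumes "norm z < 1" "norm w < 1"
  shows "pseudohyperbolic_dist z w = norm (mobius z w)"
  unfolding pseudohyperbolic_dist_def
proof (rule the_equality)
  show "\<exists>\<psi> :: complex ^ 'a \<Rightarrow> complex ^ 'a. biholomorphic_map (ball 0 1) (ball 0 1) \<psi> \<and> \<psi> z = 0 \<and> norm (mobius z w) = dist 0 (\<psi> w)"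
    using mobius_biholomorphic[OF assms(1)] mobius_self[OF assms(1)] by (intro exI[of _ "mobius z"]) simp
  fix d
  assume "\<exists>\<psi> :: complex ^ 'a \<Rightarrow> complex ^ 'a. biholomorphic_map (ball 0 1) (ball 0 1) \<psi> \<and> \<psi> z = 0 \<and> d = dist 0 (\<psi> w)"
  then obtain \<psi> :: "complex ^ 'a \<Rightarrow> complex ^ 'a" where "biholomorphic_map (ball 0 1) (ball 0 1) \<psi>" "\<psi> z = 0" "d = norm (\<psi> w)"
    by auto
  then show "d = norm (mobius z w)"
    using biholomorphic_fixing_same_norm[of \<psi> z "mobius z" w] biholomorphic_fixing_same_norm[of "mobius z" z \<psi> w]
      mobius_biholomorphic[OF assms(1)] mobius_self[OF assms(1)] assms by force
qed

section \<open>The complex inner product of the Fock space\<close>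

lemma fock_inner_add_left: "fock_inner (x + y) z = fock_inner x z + fock_inner y z"
  unfolding fock_inner_def plus_fock.rep_eq
  by (subst infsum_add[symmetric]) (auto simp: fock_inner_summable algebra_simps)

lemma fock_inner_scale_left: "fock_inner (c \<cdot>\<^sub>F x) y = c * fock_inner x y"
  unfolding fock_inner_def fock_scale.rep_eq
  by (simp add: infsum_cmult_right' mult.assoc)

lemma cnj_fock_inner: "cnj (fock_inner x y) = fock_inner y x"
  unfolding fock_inner_def infsum_cnj[symmetric] by (simp add: mult.commute)

lemma fock_inner_add_right: "fock_inner z (x + y) = fock_inner z x + fock_inner z y"
  by (metis cnj_fock_inner complex_cnj_add fock_inner_add_left)

lemma fock_inner_scale_right: "fock_inner x (c \<cdot>\<^sub>F y) = cnj c * fock_inner x y"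
  by (metis cnj_fock_inner complex_cnj_mult fock_inner_scale_left)

lemma fock_inner_diff_left: "fock_inner (x - y) z = fock_inner x z - fock_inner y z"
  using fock_inner_add_left[of "x - y" y z] by simp

lemma fock_inner_diff_right: "fock_inner z (x - y) = fock_inner z x - fock_inner z y"
  by (metis cnj_fock_inner complex_cnj_diff fock_inner_diff_left)

lemma fock_inner_norm: "fock_inner x x = of_real ((norm x)\<^sup>2)"
  by (simp only: fock_inner_self norm_fock_sq)

lemma Re_fock_inner: "Re (fock_inner x y) = inner x y"
  by (simp add: inner_fock_def)

lemma norm_fock_inner_le: "cmod (fock_inner x y) \<le> norm x * norm y"
proof -
  have "(cmod (fock_inner x y))\<^sup>2 = Re (fock_inner x (fock_inner x y \<cdot>\<^sub>F y))"
    unfolding fock_inner_scale_right by (simp add: cmod_power2) (simp add: power2_eq_square)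
  also have "\<dots> \<le> norm x * (cmod (fock_inner x y) * norm y)"
    unfolding Re_fock_inner using norm_cauchy_schwarz[of x "fock_inner x y \<cdot>\<^sub>F y"]
    by (simp add: norm_fock_scale)
  finally have "cmod (fock_inner x y) * cmod (fock_inner x y) \<le> cmod (fock_inner x y) * (norm x * norm y)"
    by (simp add: power2_eq_square mult_ac)
  then show ?thesis
    by (cases "fock_inner x y = 0") (auto simp: mult_le_cancel_left)
qed

lemma norm_add_squared_fock:
  "(norm (x + y :: 'n fock))\<^sup>2 = (norm x)\<^sup>2 + 2 * Re (fock_inner x y) + (norm y)\<^sup>2"
  by (simp add: Re_fock_inner power2_norm_eq_inner inner_add_left inner_add_right inner_commute)

lemma norm_diff_squared_fock:
  "(norm (x - y :: 'n fock))\<^sup>2 = (norm x)\<^sup>2 - 2 * Re (fock_inner x y) + (norm y)\<^sup>2"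
  by (simp add: Re_fock_inner power2_norm_eq_inner inner_diff_left inner_diff_right inner_commute)

lemma bounded_linear_fock_inner: "bounded_linear (\<lambda>x. fock_inner x y)"
proof (rule bounded_linear_intro[where K = "norm y"])
  fix x :: "'a fock" and r :: real
  have "r *\<^sub>R x = of_real r \<cdot>\<^sub>F x"
    by transfer (simp add: scaleR_conv_of_real)
  then show "fock_inner (r *\<^sub>R x) y = r *\<^sub>R fock_inner x y"
    by (simp add: fock_inner_scale_left scaleR_conv_of_real)
qed (simp_all add: fock_inner_add_left norm_fock_inner_le)

lemma fock_eqI:
  assumes "\<And>w. coord x w = coord y w"
  shows "x = y"
  using assms by (metis coord_inject ext)

lemma coord_sum: "coord (\<Sum>i\<in>I. f i) w = (\<Sum>i\<in>I. coord (f i) w)"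
  by (induction I rule: infinite_finite_induct) (auto simp: zero_fock.rep_eq plus_fock.rep_eq)

section \<open>Basis vectors and the Riesz representation theorem\<close>

lift_definition fock_unit :: "'n list \<Rightarrow> 'n fock" is "\<lambda>v w. if w = v then 1 else 0"
proof -
  fix v :: "'n list"
  have "(\<lambda>w. (cmod (if w = v then 1 else 0))\<^sup>2) summable_on {v}"
    by simp
  then show "(\<lambda>w. (cmod (if w = v then 1 else 0))\<^sup>2) summable_on UNIV"
    by (rule summable_on_cong_neutral[THEN iffD1, rotated -1]) auto
qed

abbreviation vacuum :: "'n fock" where
  "vacuum \<equiv> fock_unit []"

lemma fock_inner_unit: "fock_inner x (fock_unit v) = coord x v"
proof -
  have "fock_inner x (fock_unit v) = (\<Sum>\<^sub>\<infinity>w\<in>{v}. coord x w)"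
    unfolding fock_inner_def by (rule infsum_cong_neutral) (auto simp: fock_unit.rep_eq)
  then show ?thesis
    by simp
qed

definition fock_truncate :: "'n list set \<Rightarrow> ('n list \<Rightarrow> complex) \<Rightarrow> 'n fock" where
  "fock_truncate F g = (\<Sum>w\<in>F. g w \<cdot>\<^sub>F fock_unit w)"

lemma coord_fock_truncate:
  "finite F \<Longrightarrow> coord (fock_truncate F g) w = (if w \<in> F then g w else 0)"
  by (simp add: fock_truncate_def coord_sum fock_scale.rep_eq fock_unit.rep_eq sum.delta' if_distrib cong: if_cong)

lemma norm_fock_truncate:
  assumes "finite F"
  shows "(norm (fock_truncate F g))\<^sup>2 = (\<Sum>w\<in>F. (cmod (g w))\<^sup>2)"
proof -
  have "(norm (fock_truncate F g))\<^sup>2 = (\<Sum>\<^sub>\<infinity>w\<in>F. (cmod (g w))\<^sup>2)"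
    unfolding norm_fock_sq by (rule infsum_cong_neutral) (auto simp: coord_fock_truncate[OF assms])
  then show ?thesis
    using assms by simp
qed

lemma fock_truncate_tendsto:
  "((\<lambda>F. norm (x - fock_truncate F (coord x))) \<longlongrightarrow> 0) (finite_subsets_at_top UNIV)"
proof -
  have *: "(norm (x - fock_truncate F (coord x)))\<^sup>2 = (norm x)\<^sup>2 - (\<Sum>w\<in>F. (cmod (coord x w))\<^sup>2)"
    if "finite F" for F
  proof -
    have "fock_inner (fock_truncate F (coord x)) x = (\<Sum>w\<in>F. coord x w * cnj (coord x w))"
      unfolding fock_inner_def infsum_finite[OF that, symmetric]
      by (rule infsum_cong_neutral) (auto simp: coord_fock_truncate[OF that])
    then have "Re (fock_inner (fock_truncate F (coord x)) x) = (\<Sum>w\<in>F. (cmod (coord x w))\<^sup>2)"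
      by (simp add: complex_mult_cnj cmod_power2)
    then have "Re (fock_inner x (fock_truncate F (coord x))) = (\<Sum>w\<in>F. (cmod (coord x w))\<^sup>2)"
      by (simp add: Re_fock_inner inner_commute)
    then show ?thesis
      by (simp add: norm_diff_squared_fock norm_fock_truncate that)
  qed
  have **: "norm (x - fock_truncate F (coord x)) = sqrt ((norm x)\<^sup>2 - (\<Sum>w\<in>F. (cmod (coord x w))\<^sup>2))"
    if "finite F" for F
    unfolding that[THEN *, symmetric] by simp
  have "((\<lambda>F. sqrt ((norm x)\<^sup>2 - (\<Sum>w\<in>F. (cmod (coord x w))\<^sup>2))) \<longlongrightarrow> sqrt ((norm x)\<^sup>2 - (norm x)\<^sup>2))
      (finite_subsets_at_top UNIV)"
    using has_sum_infsum[OF coord_summable[of x]] unfolding norm_fock_sq[symmetric] has_sum_def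
    by (intro tendsto_real_sqrt tendsto_diff tendsto_const)
  then have "((\<lambda>F. sqrt ((norm x)\<^sup>2 - (\<Sum>w\<in>F. (cmod (coord x w))\<^sup>2))) \<longlongrightarrow> 0)
      (finite_subsets_at_top UNIV)"
    by simp
  moreover have "\<forall>\<^sub>F F in finite_subsets_at_top UNIV.
      sqrt ((norm x)\<^sup>2 - (\<Sum>w\<in>F. (cmod (coord x w))\<^sup>2)) = norm (x - fock_truncate F (coord x))"
    by (rule eventually_finite_subsets_at_top_weakI) (simp add: **)
  ultimately show ?thesis
    by (rule Lim_transform_eventually)
qed

text \<open>
  The representing vector has the coordinates \<open>cnj (f (fock_unit w))\<close>.  Testing \<open>f\<close> on the truncations
  of this family bounds their norms by the norm of \<open>f\<close>, so the family is square-summable;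
  truncations are dense, so agreement on basis vectors suffices.
\<close>

lemma fock_riesz:
  fixes f :: "'n fock \<Rightarrow> complex"
  assumes "bounded_linear f" and scale: "\<And>c x. f (c \<cdot>\<^sub>F x) = c * f x"
  obtains y where "\<And>x. f x = fock_inner x y"
proof -
  interpret f: bounded_linear f by fact
  obtain K where K: "\<And>x. cmod (f x) \<le> norm x * K" "K > 0"
    using f.pos_bounded by blast
  define a where "a w = cnj (f (fock_unit w))" for w
  have f_trunc: "f (fock_truncate F g) = (\<Sum>w\<in>F. g w * cnj (a w))" for F g
    by (simp add: fock_truncate_def f.sum scale a_def)
  have bound: "(\<Sum>w\<in>F. (cmod (a w))\<^sup>2) \<le> K\<^sup>2" if "finite F" for F
  proof -
    define S where "S = norm (fock_truncate F a)"
    have S: "S\<^sup>2 = (\<Sum>w\<in>F. (cmod (a w))\<^sup>2)"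
      by (simp add: S_def norm_fock_truncate that)
    have "f (fock_truncate F a) = of_real (S\<^sup>2)"
      by (simp add: f_trunc S flip: complex_norm_square)
    then have "S * S \<le> S * K"
      using K(1)[of "fock_truncate F a"] by (simp add: S_def power2_eq_square norm_mult)
    then have "S \<le> K"
      using K(2) by (cases "S = 0") (auto simp: S_def mult_le_cancel_left)
    then show ?thesis
      unfolding S[symmetric] by (intro power_mono) (auto simp: S_def)
  qed
  have "(\<lambda>w. (cmod (a w))\<^sup>2) summable_on UNIV"
    by (rule nonneg_bdd_above_summable_on) (use bound in \<open>auto intro!: bdd_aboveI2\<close>)
  then have coord_a: "coord (Abs_fock a) = a"
    by (simp add: Abs_fock_inverse)
  define y where "y = Abs_fock a"
  define g where "g x = f x - fock_inner x y" for x
  have g: "bounded_linear g"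
    unfolding g_def by (intro bounded_linear_sub f.bounded_linear_axioms bounded_linear_fock_inner)
  then interpret g: bounded_linear g .
  have g_trunc: "g (fock_truncate F h) = 0" for F h
  proof -
    have "g (h w \<cdot>\<^sub>F fock_unit w) = 0" for w
    proof -
      have "fock_inner (fock_unit w) y = cnj (a w)"
        by (metis cnj_fock_inner fock_inner_unit coord_a y_def)
      then show ?thesis
        by (simp add: g_def scale fock_inner_scale_left a_def)
    qed
    then show ?thesis
      by (simp add: fock_truncate_def g.sum)
  qed
  have "g x = 0" for x
  proof -
    obtain C where C: "\<And>x. cmod (g x) \<le> norm x * C"
      using g.bounded by blast
    have "((\<lambda>F. norm (x - fock_truncate F (coord x)) * C) \<longlongrightarrow> 0 * C) (finite_subsets_at_top UNIV)"
      by (intro tendsto_intros fock_truncate_tendsto)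
    moreover have "cmod (g x) \<le> norm (x - fock_truncate F (coord x)) * C" for F
      using C[of "x - fock_truncate F (coord x)"] by (simp add: g.diff g_trunc)
    ultimately have "cmod (g x) \<le> 0 * C"
      by (intro tendsto_lowerbound[where F = "finite_subsets_at_top UNIV"]) auto
    then show ?thesis
      by simp
  qed
  then show ?thesis
    by (intro that[of y]) (simp add: g_def)
qed

section \<open>Creation by an arbitrary vector\<close>

text \<open>
  For \<open>u = v\<close> of norm one this is the isometry of a creation operator; for orthogonal \<open>u\<close> and \<open>v\<close>
  it says that creation operators have orthogonal ranges.  All norm computations below rest on it.
\<close>

lemma fock_inner_tensor_left:
  "fock_inner (tensor_left u x) (tensor_left v y) = herm u v * fock_inner x y"
proof -
  let ?f = "\<lambda>w. coord (tensor_left u x) w * cnj (coord (tensor_left v y) w)"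
  have "(?f has_sum (u $ i * cnj (v $ i) * fock_inner x y)) (Cons i ` UNIV)" for i
    using has_sum_cmult_right[OF has_sum_infsum[OF fock_inner_summable[of x y]], of "u $ i * cnj (v $ i)"]
    by (subst has_sum_reindex) (auto simp: o_def tensor_left.rep_eq fock_inner_def mult_ac)
  then have "(?f has_sum (\<Sum>i\<in>UNIV. u $ i * cnj (v $ i) * fock_inner x y)) (\<Union>i\<in>UNIV. Cons i ` UNIV)"
    by (intro sum_has_sum) auto
  moreover have "(?f has_sum s) (\<Union>i\<in>UNIV. Cons i ` UNIV) \<longleftrightarrow> (?f has_sum s) UNIV" for s
    by (rule has_sum_cong_neutral) (auto simp: tensor_left.rep_eq split: list.splits)
  ultimately have "(?f has_sum (\<Sum>i\<in>UNIV. u $ i * cnj (v $ i) * fock_inner x y)) UNIV"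
    by blast
  then show ?thesis
    unfolding fock_inner_def[of "tensor_left u x"] herm_def sum_distrib_right by (rule infsumI)
qed

lemma fock_inner_vacuum_tensor_left [simp]:
  "fock_inner (tensor_left v x) vacuum = 0" "fock_inner vacuum (tensor_left v x) = 0"
proof -
  show "fock_inner (tensor_left v x) vacuum = 0"
    by (simp add: fock_inner_unit tensor_left.rep_eq)
  then show "fock_inner vacuum (tensor_left v x) = 0"
    by (metis cnj_fock_inner complex_cnj_zero)
qed

lemma fock_inner_vacuum_self [simp]: "fock_inner vacuum vacuum = 1"
  by (simp add: fock_inner_unit fock_unit.rep_eq)

lemma tensor_left_diff: "tensor_left v (x - y) = tensor_left v x - tensor_left v y"
  by transfer (auto simp: fun_eq_iff algebra_simps split: list.splits)

definition create :: "complex ^ 'n \<Rightarrow> ('n::finite fock \<Rightarrow>\<^sub>L 'n fock)" where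
  "create v = (\<Sum>j\<in>UNIV. op_scale (v $ j) (creation j))"

lemma create_apply: "blinfun_apply (create v) x = tensor_left v x"
proof -
  have *: "coord (blinfun_apply (create v) x) w = (\<Sum>j\<in>UNIV. v $ j * coord (tensor_left (axis j 1) x) w)" for w
    by (simp only: create_def blinfun.sum_left coord_sum op_scale_apply fock_scale.rep_eq creation.rep_eq)
  show ?thesis
  proof (rule fock_eqI)
    fix w
    show "coord (blinfun_apply (create v) x) w = coord (tensor_left v x) w"
    proof (cases w)
      case (Cons i u)
      have "(\<Sum>j\<in>UNIV. v $ j * (axis j 1 $ i * coord x u)) = (\<Sum>j\<in>UNIV. if j = i then v $ i * coord x u else 0)"
        by (rule sum.cong) (auto simp: axis_def)
      then show ?thesis
        unfolding * Cons tensor_left.rep_eq by simp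
    qed (simp add: * tensor_left.rep_eq)
  qed
qed

lemma create_in_algebra: "create v \<in> creation_algebra"
proof -
  have "op_scale 0 id_blinfun = (0 :: 'a fock \<Rightarrow>\<^sub>L 'a fock)"
    by (rule blinfun_eqI) (rule fock_eqI, simp add: op_scale_apply fock_scale.rep_eq zero_fock.rep_eq)
  then have "0 \<in> (creation_algebra :: ('a fock \<Rightarrow>\<^sub>L 'a fock) set)"
    using creation_algebra.scale[OF creation_algebra.one, of 0] by metis
  then have "(\<Sum>j\<in>J. op_scale (v $ j) (creation j)) \<in> creation_algebra" for J
    by (induction J rule: infinite_finite_induct) (auto intro: creation_algebra.intros)
  then show ?thesis
    by (simp add: create_def)
qed

section \<open>The weak operator topology\<close>

lemma topspace_weak [simp]: "topspace weak_operator_topology = bounded_operators"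
proof -
  have "(bounded_operators :: ('a fock \<Rightarrow>\<^sub>L 'a fock) set)
      = {T \<in> bounded_operators. fock_inner (blinfun_apply T 0) 0 \<in> UNIV}"
    by simp
  then show ?thesis
    unfolding weak_operator_topology_def topology_generated_by_topspace using open_UNIV by blast
qed

lemma continuous_map_matrix_element:
  "continuous_map weak_operator_topology euclidean (\<lambda>T. fock_inner (blinfun_apply T x) y)"
  unfolding continuous_map_def weak_operator_topology_def
proof (intro conjI allI impI)
  fix U :: "complex set"
  assume "openin euclidean U"
  then have "openin weak_operator_topology {T \<in> bounded_operators. fock_inner (blinfun_apply T x) y \<in> U}"
    unfolding weak_operator_topology_def by (intro topology_generated_by_Basis) auto
  then show "openin (topology_generated_by
      {{T \<in> bounded_operators. fock_inner (blinfun_apply T x) y \<in> U} | x y U. open U})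
      {T \<in> topspace (topology_generated_by
        {{T \<in> bounded_operators. fock_inner (blinfun_apply T x) y \<in> U} | x y U. open U}).
        fock_inner (blinfun_apply T x) y \<in> U}"
    unfolding weak_operator_topology_def[symmetric] by simp
qed simp

text \<open>
  The weak operator topology is initial for the matrix elements, so continuity into it can be tested
  on them.
\<close>

lemma continuous_map_into_weak:
  fixes F :: "'b \<Rightarrow> ('a fock \<Rightarrow>\<^sub>L 'a fock)"
  assumes "F \<in> topspace X \<rightarrow> bounded_operators"
    and "\<And>x y. continuous_map X euclidean (\<lambda>t. fock_inner (blinfun_apply (F t) x) y)"
  shows "continuous_map X weak_operator_topology F"
  unfolding weak_operator_topology_def
proof (rule continuous_on_generated_topo)
  fix U :: "('a fock \<Rightarrow>\<^sub>L 'a fock) set"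
  assume "U \<in> {{T \<in> bounded_operators. fock_inner (blinfun_apply T x) y \<in> V} | x y V. open V}"
  then obtain x y V where U: "U = {T \<in> bounded_operators. fock_inner (blinfun_apply T x) y \<in> V}" "open V"
    by blast
  have "openin X {t \<in> topspace X. fock_inner (blinfun_apply (F t) x) y \<in> V}"
    using assms(2)[of x y] U(2) by (auto simp: continuous_map_def)
  also have "{t \<in> topspace X. fock_inner (blinfun_apply (F t) x) y \<in> V} = F -` U \<inter> topspace X"
    using assms(1) U(1) by auto
  finally show "openin X (F -` U \<inter> topspace X)" .
next
  show "F ` topspace X \<subseteq> \<Union> {{T \<in> bounded_operators. fock_inner (blinfun_apply T x) y \<in> V} | x y V. open V}"
    using assms(1) topspace_weak unfolding weak_operator_topology_def topology_generated_by_topspace by blast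
qed

lemma continuous_map_cmult:
  fixes f :: "'b \<Rightarrow> complex"
  shows "continuous_map X euclidean f \<Longrightarrow> continuous_map X euclidean (\<lambda>t. c * f t)"
  by (simp add: continuous_map_atin tendsto_mult)

text \<open>
  The vector \<open>v\<close> is the value at \<open>y\<close> of the adjoint of \<open>S\<close>.  It turns left multiplication
  by \<open>S\<close> into a change of matrix element, which is what makes \<open>T \<mapsto> S o\<^sub>L T\<close> weak operator
  continuous.
\<close>

lemma bounded_operators_adjoint:
  assumes "S \<in> bounded_operators"
  obtains v where "\<And>x. fock_inner (blinfun_apply S x) y = fock_inner x v"
proof (rule fock_riesz)
  show "bounded_linear (\<lambda>x. fock_inner (blinfun_apply S x) y)"
    by (rule bounded_linear_compose[OF bounded_linear_fock_inner blinfun.bounded_linear_right])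
  show "fock_inner (blinfun_apply S (c \<cdot>\<^sub>F x)) y = c * fock_inner (blinfun_apply S x) y" for c x
    using assms by (simp add: bounded_operators_def fock_inner_scale_left)
qed (use that in blast)

lemma fock_scale_add: "c \<cdot>\<^sub>F (x + y) = c \<cdot>\<^sub>F x + c \<cdot>\<^sub>F y"
  and fock_scale_commute: "c \<cdot>\<^sub>F d \<cdot>\<^sub>F x = d \<cdot>\<^sub>F c \<cdot>\<^sub>F x"
  by (transfer; simp add: algebra_simps)+

lemma bounded_operators_one: "id_blinfun \<in> bounded_operators"
  and bounded_operators_add:
    "S \<in> bounded_operators \<Longrightarrow> T \<in> bounded_operators \<Longrightarrow> S + T \<in> bounded_operators"
  and bounded_operators_scale: "T \<in> bounded_operators \<Longrightarrow> op_scale c T \<in> bounded_operators"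
  and bounded_operators_mult:
    "S \<in> bounded_operators \<Longrightarrow> T \<in> bounded_operators \<Longrightarrow> S o\<^sub>L T \<in> bounded_operators"
  by (auto simp: bounded_operators_def blinfun.add_left op_scale_apply fock_scale_add intro: fock_scale_commute)

lemma bounded_operators_creation: "creation j \<in> bounded_operators"
  unfolding bounded_operators_def creation.rep_eq mem_Collect_eq
  by (intro allI, transfer) (auto simp: fun_eq_iff split: list.splits)

lemma creation_algebra_bounded: "creation_algebra \<subseteq> bounded_operators"
proof
  show "T \<in> bounded_operators" if "T \<in> creation_algebra" for T :: "'a fock \<Rightarrow>\<^sub>L 'a fock"
    using that
    by induction (simp_all add: bounded_operators_one bounded_operators_creation bounded_operators_add
        bounded_operators_scale bounded_operators_mult)
qed

lemma hardy_algebra_bounded: "hardy_algebra \<subseteq> bounded_operators"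
  unfolding hardy_algebra_def using closure_of_subset_topspace[of weak_operator_topology] by simp

lemma creation_algebra_hardy: "creation_algebra \<subseteq> hardy_algebra"
  unfolding hardy_algebra_def by (intro closure_of_subset) (simp add: creation_algebra_bounded)

lemma closedin_hardy: "closedin weak_operator_topology hardy_algebra"
  by (simp add: hardy_algebra_def)

lemma weak_continuous_add_left: "T \<in> bounded_operators \<Longrightarrow>
    continuous_map weak_operator_topology weak_operator_topology (\<lambda>S. S + T)"
  by (rule continuous_map_into_weak)
    (auto simp: bounded_operators_add blinfun.add_left fock_inner_add_left
      intro!: continuous_map_add continuous_map_matrix_element)

lemma weak_continuous_add_right: "S \<in> bounded_operators \<Longrightarrow>
    continuous_map weak_operator_topology weak_operator_topology (\<lambda>T. S + T)"
  by (rule continuous_map_into_weak)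
    (auto simp: bounded_operators_add blinfun.add_left fock_inner_add_left
      intro!: continuous_map_add continuous_map_matrix_element)

lemma weak_continuous_scale:
  "continuous_map weak_operator_topology weak_operator_topology (op_scale c)"
  by (rule continuous_map_into_weak)
    (auto simp: bounded_operators_scale op_scale_apply fock_inner_scale_left
      intro!: continuous_map_cmult continuous_map_matrix_element)

lemma weak_continuous_mult_left: "T \<in> bounded_operators \<Longrightarrow>
    continuous_map weak_operator_topology weak_operator_topology (\<lambda>S. S o\<^sub>L T)"
  by (rule continuous_map_into_weak)
    (auto simp: bounded_operators_mult intro!: continuous_map_matrix_element)

lemma weak_continuous_mult_right:
  assumes "S \<in> bounded_operators"
  shows "continuous_map weak_operator_topology weak_operator_topology (\<lambda>T. S o\<^sub>L T)"
proof (rule continuous_map_into_weak)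
  fix x y :: "'a fock"
  obtain v where "\<And>x. fock_inner (blinfun_apply S x) y = fock_inner x v"
    using bounded_operators_adjoint[OF assms] by blast
  then show "continuous_map weak_operator_topology euclidean (\<lambda>T. fock_inner (blinfun_apply (S o\<^sub>L T) x) y)"
    by (simp add: continuous_map_matrix_element)
qed (use assms in \<open>auto simp: bounded_operators_mult\<close>)

section \<open>The Hardy algebra is a norm-closed algebra\<close>

lemma hardy_maps:
  assumes "continuous_map weak_operator_topology weak_operator_topology F"
    and "\<And>T. T \<in> creation_algebra \<Longrightarrow> F T \<in> hardy_algebra" and "T \<in> hardy_algebra"
  shows "F T \<in> hardy_algebra"
proof -
  have "F ` (weak_operator_topology closure_of creation_algebra)
      \<subseteq> weak_operator_topology closure_of (F ` creation_algebra)"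
    by (rule continuous_map_image_closure_subset[OF assms(1)])
  also have "\<dots> \<subseteq> hardy_algebra"
    using assms(2) by (intro closure_of_minimal closedin_hardy) auto
  finally show ?thesis
    using assms(3) unfolding hardy_algebra_def by blast
qed

lemma hardy_scale:
  assumes "T \<in> hardy_algebra"
  shows "op_scale c T \<in> hardy_algebra"
proof (rule hardy_maps[OF weak_continuous_scale _ assms])
  show "op_scale c A \<in> hardy_algebra" if "A \<in> creation_algebra" for A :: "'a fock \<Rightarrow>\<^sub>L 'a fock"
    using that creation_algebra_hardy creation_algebra.scale by blast
qed

lemma hardy_add:
  assumes "S \<in> hardy_algebra" "T \<in> hardy_algebra"
  shows "S + T \<in> hardy_algebra"
proof (rule hardy_maps[OF weak_continuous_add_right _ assms(2)])
  show "S \<in> bounded_operators"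
    using assms hardy_algebra_bounded by blast
  fix A :: "'a fock \<Rightarrow>\<^sub>L 'a fock"
  assume A: "A \<in> creation_algebra"
  show "S + A \<in> hardy_algebra"
  proof (rule hardy_maps[OF weak_continuous_add_left _ assms(1)])
    show "A \<in> bounded_operators"
      using A creation_algebra_bounded by blast
    show "B + A \<in> hardy_algebra" if "B \<in> creation_algebra" for B
      using that A creation_algebra_hardy creation_algebra.add by blast
  qed
qed

text \<open>
  Multiplication is only separately continuous in the weak operator topology, so the closure is
  taken in one factor at a time.
\<close>

lemma hardy_mult:
  assumes "S \<in> hardy_algebra" "T \<in> hardy_algebra"
  shows "S o\<^sub>L T \<in> hardy_algebra"
proof (rule hardy_maps[OF weak_continuous_mult_right _ assms(2)])
  show "S \<in> bounded_operators"
    using assms hardy_algebra_bounded by blast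
  fix A :: "'a fock \<Rightarrow>\<^sub>L 'a fock"
  assume A: "A \<in> creation_algebra"
  show "S o\<^sub>L A \<in> hardy_algebra"
  proof (rule hardy_maps[OF weak_continuous_mult_left _ assms(1)])
    show "A \<in> bounded_operators"
      using A creation_algebra_bounded by blast
    show "B o\<^sub>L A \<in> hardy_algebra" if "B \<in> creation_algebra" for B
      using that A creation_algebra_hardy creation_algebra.mult by blast
  qed
qed

text \<open>
  The norm topology is finer than the weak operator topology, and the \<open>\<complex>\<close>-linear operators are norm
  closed among all \<open>\<real>\<close>-linear ones.
\<close>

lemma closed_hardy: "closed (hardy_algebra :: ('n::finite fock \<Rightarrow>\<^sub>L 'n fock) set)"
proof -
  have eq: "bounded_operators = (\<Inter>c. \<Inter>x. {T :: 'n fock \<Rightarrow>\<^sub>L 'n fock. blinfun_apply T (c \<cdot>\<^sub>F x) = c \<cdot>\<^sub>F blinfun_apply T x})"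
    by (auto simp: bounded_operators_def)
  have "closed {T :: 'n fock \<Rightarrow>\<^sub>L 'n fock. blinfun_apply T (c \<cdot>\<^sub>F x) = c \<cdot>\<^sub>F blinfun_apply T x}" for c x
    by (intro closed_Collect_eq bounded_linear.continuous_on[OF bounded_linear_fock_scale] continuous_intros)
  then have closed: "closed (bounded_operators :: ('n fock \<Rightarrow>\<^sub>L 'n fock) set)"
    unfolding eq by (intro closed_INT ballI)
  have "continuous_map (top_of_set (bounded_operators :: ('n fock \<Rightarrow>\<^sub>L 'n fock) set)) weak_operator_topology (\<lambda>T. T)"
  proof (rule continuous_map_into_weak)
    fix x y :: "'n fock"
    have "continuous_on bounded_operators (\<lambda>T. fock_inner (blinfun_apply T x) y)"
      by (intro bounded_linear.continuous_on[OF bounded_linear_fock_inner] continuous_intros)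
    then show "continuous_map (top_of_set bounded_operators) euclidean (\<lambda>T. fock_inner (blinfun_apply T x) y)"
      by simp
  qed auto
  then have "closedin (top_of_set bounded_operators) {T \<in> bounded_operators. T \<in> (hardy_algebra :: ('n fock \<Rightarrow>\<^sub>L 'n fock) set)}"
    using closedin_continuous_map_preimage[OF _ closedin_hardy] by fastforce
  also have "{T \<in> bounded_operators. T \<in> (hardy_algebra :: ('n fock \<Rightarrow>\<^sub>L 'n fock) set)} = hardy_algebra"
    using hardy_algebra_bounded by blast
  finally show ?thesis
    using closed closedin_closed_trans by blast
qed

section \<open>Kernel vectors and point evaluations\<close>

definition conj_vec :: "complex ^ 'n \<Rightarrow> complex ^ 'n" where
  "conj_vec v = (\<chi> i. cnj (v $ i))"

lemma norm_conj_vec [simp]: "norm (conj_vec v) = norm v"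
  by (simp add: conj_vec_def norm_vec_def)

lemma herm_conj_vec [simp]: "herm (conj_vec u) (conj_vec v) = herm v u"
  by (simp add: conj_vec_def herm_def mult.commute)

lemma herm_axis_conj_vec: "herm (axis j 1) (conj_vec l) = l $ j"
proof -
  have "herm (axis j 1) (conj_vec l) = (\<Sum>i\<in>UNIV. if i = j then l $ i else 0)"
    unfolding herm_def by (rule sum.cong) (auto simp: axis_def conj_vec_def)
  then show ?thesis
    by simp
qed

text \<open>
  The free Szego kernel vector.  Its coordinates \<open>cnj (l i\<^sub>1 \<dots> l i\<^sub>k)\<close> are those of the geometric series
  generated from the vacuum by \<open>\<xi> \<mapsto> conj_vec l \<otimes> \<xi>\<close>; characterizing it as the fixed point of a
  contraction gives square-summability at no cost, and the fixed point equation is all that is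
  used of it.
\<close>

definition szego :: "complex ^ 'n \<Rightarrow> 'n::finite fock" where
  "szego l = (THE k. k = vacuum + tensor_left (conj_vec l) k)"

lemma szego_eq:
  assumes "norm l < 1"
  shows "szego l = vacuum + tensor_left (conj_vec l) (szego l)"
proof -
  have "\<exists>!k. vacuum + tensor_left (conj_vec l) k = k"
    by (rule banach_fix_type[where c = "norm l"])
      (use assms in \<open>auto simp: dist_norm norm_tensor_left simp flip: tensor_left_diff\<close>)
  then have "\<exists>!k. k = vacuum + tensor_left (conj_vec l) k"
    by metis
  from theI'[OF this] show ?thesis
    by (simp only: szego_def)
qed

lemma fock_inner_vacuum_szego [simp]: "norm l < 1 \<Longrightarrow> fock_inner vacuum (szego l) = 1"
  by (subst szego_eq) (simp_all add: fock_inner_add_right)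

text \<open>
  That is, \<open>szego l\<close> is a joint eigenvector of the adjoints of the creation operators.
\<close>

lemma fock_inner_tensor_left_szego:
  assumes "norm l < 1"
  shows "fock_inner (tensor_left v x) (szego l) = herm v (conj_vec l) * fock_inner x (szego l)"
proof -
  have "fock_inner (tensor_left v x) (szego l)
      = fock_inner (tensor_left v x) (vacuum + tensor_left (conj_vec l) (szego l))"
    using szego_eq[OF assms] by simp
  then show ?thesis
    by (simp add: fock_inner_add_right fock_inner_tensor_left)
qed

lemma fock_inner_szego:
  assumes "norm z < 1" "norm w < 1"
  shows "fock_inner (szego z) (szego w) = 1 / (1 - herm w z)"
proof -
  have "fock_inner (szego z) (szego w) = fock_inner (vacuum + tensor_left (conj_vec z) (szego z)) (szego w)"
    using szego_eq[OF assms(1)] by simp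
  also have "\<dots> = 1 + herm w z * fock_inner (szego z) (szego w)"
    using assms by (simp add: fock_inner_add_left fock_inner_tensor_left_szego)
  finally show ?thesis
    using herm_neq_one[OF assms(2,1)] by (simp add: field_simps)
qed

lemma norm_szego:
  assumes "norm l < 1"
  shows "(norm (szego l))\<^sup>2 = 1 / (1 - (norm l)\<^sup>2)"
proof -
  have "complex_of_real ((norm (szego l))\<^sup>2) = of_real (1 / (1 - (norm l)\<^sup>2))"
    unfolding fock_inner_norm[symmetric] fock_inner_szego[OF assms assms] by (simp add: herm_self)
  then show ?thesis
    using of_real_eq_iff by blast
qed

text \<open>
  Vectors that are eigenvectors of the adjoint of an operator stay so under sums and products, and
  the eigenvalue is a matrix element, hence passes to weak operator limits.  Taking \<open>x\<close> to be the
  vacuum identifies the eigenvalue.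
\<close>

lemma hardy_szego:
  assumes "norm l < 1" and "T \<in> hardy_algebra"
  shows "fock_inner (blinfun_apply T x) (szego l) =
    fock_inner x (szego l) * fock_inner (blinfun_apply T vacuum) (szego l)"
proof -
  have "\<exists>p. \<forall>x. fock_inner (blinfun_apply T x) (szego l) = p * fock_inner x (szego l)"
    if "T \<in> creation_algebra" for T
    using that
  proof induction
    case one
    show ?case
      by (intro exI[of _ 1]) simp
  next
    case (creation j)
    show ?case
      using assms(1) by (auto simp: creation.rep_eq fock_inner_tensor_left_szego)
  next
    case (add S T)
    then obtain p q where "\<forall>x. fock_inner (blinfun_apply S x) (szego l) = p * fock_inner x (szego l)"
      "\<forall>x. fock_inner (blinfun_apply T x) (szego l) = q * fock_inner x (szego l)"
      by blast
    then show ?case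
      by (intro exI[of _ "p + q"]) (simp add: blinfun.add_left fock_inner_add_left distrib_right)
  next
    case (scale T c)
    then obtain p where "\<forall>x. fock_inner (blinfun_apply T x) (szego l) = p * fock_inner x (szego l)"
      by blast
    then show ?case
      by (intro exI[of _ "c * p"]) (simp add: op_scale_apply fock_inner_scale_left)
  next
    case (mult S T)
    then obtain p q where "\<forall>x. fock_inner (blinfun_apply S x) (szego l) = p * fock_inner x (szego l)"
      "\<forall>x. fock_inner (blinfun_apply T x) (szego l) = q * fock_inner x (szego l)"
      by blast
    then show ?case
      by (intro exI[of _ "p * q"]) simp
  qed
  then have alg: "fock_inner (blinfun_apply T x) (szego l) =
      fock_inner x (szego l) * fock_inner (blinfun_apply T vacuum) (szego l)" if "T \<in> creation_algebra" for T
    using that assms(1) by fastforce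
  show ?thesis
  proof (rule forall_in_closure_of_eq[where X = weak_operator_topology and Y = euclidean and S = creation_algebra
        and f = "\<lambda>T. fock_inner (blinfun_apply T x) (szego l)"])
    show "T \<in> weak_operator_topology closure_of creation_algebra"
      using assms(2) by (simp add: hardy_algebra_def)
    show "continuous_map weak_operator_topology euclidean
        (\<lambda>T. fock_inner x (szego l) * fock_inner (blinfun_apply T vacuum) (szego l))"
      by (intro continuous_map_cmult continuous_map_matrix_element)
  qed (use alg continuous_map_matrix_element in auto)
qed

text \<open>
  The matrix element on the right defines a character: multiplicativity is the eigenvector property
  \<open>hardy_szego\<close>.  It is the only continuous one with these values on the generators, since the
  algebra they generate is dense.
\<close>

lemma hardy_eval_eq:
  assumes "norm l < 1" and \<phi>: "\<phi> \<in> hardy_algebra"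
  shows "hardy_eval \<phi> l = fock_inner (blinfun_apply \<phi> vacuum) (szego l)"
proof -
  define \<pi> where "\<pi> = restrict (\<lambda>T. fock_inner (blinfun_apply T vacuum) (szego l)) hardy_algebra"
  have hardy: "id_blinfun \<in> hardy_algebra" "creation j \<in> hardy_algebra" for j :: 'a
    using creation_algebra_hardy by (auto intro: creation_algebra.intros)
  have cont: "continuous_map (subtopology weak_operator_topology hardy_algebra) euclidean \<pi>"
    by (rule continuous_map_eq[OF continuous_map_from_subtopology[OF continuous_map_matrix_element]])
      (auto simp: \<pi>_def)
  have "point_character l \<pi>"
    unfolding point_character_def
  proof (intro conjI ballI allI)
    show "\<pi> \<in> extensional hardy_algebra"
      by (simp add: \<pi>_def)
    show "\<pi> (creation j) = l $ j" for j
      using assms(1) by (simp add: \<pi>_def hardy creation.rep_eq fock_inner_tensor_left_szego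
          herm_axis_conj_vec)
    fix S T :: "'a fock \<Rightarrow>\<^sub>L 'a fock"
    assume ST: "S \<in> hardy_algebra" "T \<in> hardy_algebra"
    show "\<pi> (S o\<^sub>L T) = \<pi> S * \<pi> T"
      using hardy_szego[OF assms(1) ST(1), of "blinfun_apply T vacuum"] by (simp add: \<pi>_def ST hardy_mult)
  qed (use cont assms(1) in \<open>auto simp: \<pi>_def hardy hardy_add hardy_scale blinfun.add_left fock_inner_add_left
      op_scale_apply fock_inner_scale_left\<close>)
  moreover have "\<theta> = \<pi>" if \<theta>: "point_character l \<theta>" for \<theta>
  proof -
    have alg: "\<theta> T = \<pi> T" if "T \<in> creation_algebra" for T
      using that
    proof induction
      case one
      then show ?case using \<theta> \<open>point_character l \<pi>\<close> by (simp add: point_character_def)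
    next
      case (creation j)
      then show ?case using \<theta> \<open>point_character l \<pi>\<close> by (simp add: point_character_def)
    next
      case (add S T)
      then have "S \<in> hardy_algebra" "T \<in> hardy_algebra" using creation_algebra_hardy by auto
      with add show ?case using \<theta> \<open>point_character l \<pi>\<close> by (simp add: point_character_def)
    next
      case (scale T c)
      then have "T \<in> hardy_algebra" using creation_algebra_hardy by auto
      with scale show ?case using \<theta> \<open>point_character l \<pi>\<close> by (simp add: point_character_def)
    next
      case (mult S T)
      then have "S \<in> hardy_algebra" "T \<in> hardy_algebra" using creation_algebra_hardy by auto
      with mult show ?case using \<theta> \<open>point_character l \<pi>\<close> by (simp add: point_character_def)
    qed
    have "\<theta> T = \<pi> T" if T: "T \<in> hardy_algebra" for T
    proof (rule forall_in_closure_of_eq[where X = "subtopology weak_operator_topology hardy_algebra"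
          and Y = euclidean and S = creation_algebra and f = \<theta>])
      show "T \<in> subtopology weak_operator_topology hardy_algebra closure_of creation_algebra"
        using T unfolding closure_of_subtopology inf_absorb2[OF creation_algebra_hardy]
        by (simp add: hardy_algebra_def)
      show "continuous_map (subtopology weak_operator_topology hardy_algebra) euclidean \<theta>"
        using \<theta> by (simp add: point_character_def)
    qed (use alg cont in auto)
    then show ?thesis
      using \<theta> by (intro extensionalityI[where A = hardy_algebra]) (auto simp: point_character_def \<pi>_def)
  qed
  ultimately have "(THE \<pi>. point_character l \<pi>) = \<pi>"
    by blast
  then show ?thesis
    by (simp add: hardy_eval_def \<pi>_def \<phi>)
qed

section \<open>The upper bound\<close>

text \<open>
  Cauchy--Schwarz for \<open>x\<close> and the component of \<open>a\<close> orthogonal to \<open>b\<close>, multiplied by \<open>(norm b)\<^sup>2\<close> to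
  avoid dividing.
\<close>

lemma fock_inner_le_of_orthogonal:
  assumes "fock_inner x b = 0"
  shows "(norm b)\<^sup>2 * (cmod (fock_inner x a))\<^sup>2
    \<le> (norm x)\<^sup>2 * ((norm a)\<^sup>2 * (norm b)\<^sup>2 - (cmod (fock_inner a b))\<^sup>2)"
proof (cases "b = 0")
  case True
  then show ?thesis
    using fock_inner_scale_right[of a 0 b] by (simp add: fock_inner_def zero_fock.rep_eq)
next
  case False
  define q where "q = fock_inner a b"
  define p where "p = of_real ((norm b)\<^sup>2) \<cdot>\<^sub>F a - q \<cdot>\<^sub>F b"
  have "fock_inner x p = of_real ((norm b)\<^sup>2) * fock_inner x a"
    by (simp add: p_def fock_inner_diff_right fock_inner_scale_right assms)
  then have xp: "(cmod (fock_inner x p))\<^sup>2 = (norm b)\<^sup>2 * ((norm b)\<^sup>2 * (cmod (fock_inner x a))\<^sup>2)"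
    by (simp add: norm_mult norm_power power_mult_distrib power2_eq_square)
  have p: "(norm p)\<^sup>2 = (norm b)\<^sup>2 * ((norm a)\<^sup>2 * (norm b)\<^sup>2 - (cmod q)\<^sup>2)"
  proof -
    have "Re (fock_inner (of_real ((norm b)\<^sup>2) \<cdot>\<^sub>F a) (q \<cdot>\<^sub>F b)) = (norm b)\<^sup>2 * (cmod q)\<^sup>2"
      by (simp only: fock_inner_scale_left fock_inner_scale_right q_def[symmetric])
        (simp add: cmod_power2 power2_eq_square[of "Re q"] power2_eq_square[of "Im q"] algebra_simps)
    then show ?thesis
      unfolding p_def norm_diff_squared_fock
      by (simp add: norm_fock_scale power_mult_distrib algebra_simps) (simp add: power2_eq_square power4_eq_xxxx norm_mult)
  qed
  have "(cmod (fock_inner x p))\<^sup>2 \<le> (norm x * norm p)\<^sup>2"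
    by (intro power_mono norm_fock_inner_le) simp
  then have "(norm b)\<^sup>2 * ((norm b)\<^sup>2 * (cmod (fock_inner x a))\<^sup>2)
      \<le> (norm b)\<^sup>2 * ((norm x)\<^sup>2 * ((norm a)\<^sup>2 * (norm b)\<^sup>2 - (cmod q)\<^sup>2))"
    unfolding power_mult_distrib xp p by (simp only: mult.left_commute)
  then show ?thesis
    using False by (simp only: mult_le_cancel_left_pos zero_less_power zero_less_norm_iff q_def not_False_eq_True simp_thms)
qed

text \<open>
  With \<open>x = \<phi> (szego z)\<close>, the hypothesis \<open>\<phi>(w) = 0\<close> makes \<open>x\<close> orthogonal to \<open>szego w\<close>, while
  \<open>\<langle>x, szego z\<rangle> = |szego z|\<^sup>2 \<phi>(z)\<close> and \<open>|x| \<le> |szego z|\<close>.  The previous lemma bounds \<open>|\<phi>(z)|\<^sup>2\<close> by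
  \<open>1 - |\<langle>szego z, szego w\<rangle>|\<^sup>2 / (|szego z|\<^sup>2 |szego w|\<^sup>2)\<close>.
\<close>

lemma hardy_eval_le_mobius:
  fixes \<phi> :: "'n::finite fock \<Rightarrow>\<^sub>L 'n fock"
  assumes z: "norm z < 1" and w: "norm w < 1"
    and \<phi>: "\<phi> \<in> hardy_algebra" "norm \<phi> \<le> 1" and "hardy_eval \<phi> w = 0"
  shows "cmod (hardy_eval \<phi> z) \<le> norm (mobius z w)"
proof -
  define x where "x = blinfun_apply \<phi> (szego z)"
  define Z W where "Z = (norm (szego z))\<^sup>2" and "W = (norm (szego w))\<^sup>2"
  have Z: "Z = 1 / (1 - (norm z)\<^sup>2)" "Z > 0" and W: "W = 1 / (1 - (norm w)\<^sup>2)" "W > 0"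
    using z w by (simp_all add: Z_def W_def norm_szego power_less_one_iff)
  have "fock_inner x (szego w) = 0"
    using hardy_szego[OF w \<phi>(1), of "szego z"] assms(5) by (simp add: hardy_eval_eq[OF w \<phi>(1)] x_def)
  from fock_inner_le_of_orthogonal[OF this, of "szego z"]
  have "W * (cmod (fock_inner x (szego z)))\<^sup>2 \<le> (norm x)\<^sup>2 * (Z * W - (cmod (1 / (1 - herm w z)))\<^sup>2)"
    by (simp only: Z_def W_def fock_inner_szego[OF z w])
  also have "fock_inner x (szego z) = of_real Z * hardy_eval \<phi> z"
    using hardy_szego[OF z \<phi>(1), of "szego z"]
    by (simp add: hardy_eval_eq[OF z \<phi>(1)] x_def Z_def fock_inner_norm)
  also have "(norm x)\<^sup>2 * (Z * W - (cmod (1 / (1 - herm w z)))\<^sup>2) \<le> Z * (Z * W - (cmod (1 / (1 - herm w z)))\<^sup>2)"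
  proof (rule mult_right_mono)
    have "norm x \<le> norm \<phi> * norm (szego z)"
      unfolding x_def by (rule norm_blinfun)
    also have "\<dots> \<le> norm (szego z)"
      using \<phi>(2) by (simp add: mult_left_le_one_le)
    finally show "(norm x)\<^sup>2 \<le> Z"
      unfolding Z_def by (intro power_mono) auto
    have "(cmod (fock_inner (szego z) (szego w)))\<^sup>2 \<le> (norm (szego z) * norm (szego w))\<^sup>2"
      by (intro power_mono norm_fock_inner_le) simp
    then show "0 \<le> Z * W - (cmod (1 / (1 - herm w z)))\<^sup>2"
      by (simp add: fock_inner_szego[OF z w] Z_def W_def power_mult_distrib)
  qed
  finally have "Z * (Z * W * (cmod (hardy_eval \<phi> z))\<^sup>2) \<le> Z * (Z * W - (cmod (1 / (1 - herm w z)))\<^sup>2)"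
    using Z(2) by (simp add: norm_mult power_mult_distrib power2_eq_square mult_ac)
  then have "Z * W * (cmod (hardy_eval \<phi> z))\<^sup>2 \<le> Z * W - (cmod (1 / (1 - herm w z)))\<^sup>2"
    using Z(2) by (simp only: mult_le_cancel_left_pos)
  then have "(cmod (hardy_eval \<phi> z))\<^sup>2 \<le> 1 - (cmod (1 / (1 - herm w z)))\<^sup>2 / (Z * W)"
    using Z(2) W(2) by (simp add: field_simps)
  also have "(cmod (1 / (1 - herm w z)))\<^sup>2 / (Z * W) = 1 - (norm (mobius z w))\<^sup>2"
    unfolding norm_mobius[OF z w] Z(1) W(1) by (simp add: norm_divide power_divide)
  finally show ?thesis
    by (simp add: power2_le_iff_abs_le)
qed

section \<open>The extremal operator\<close>

text \<open>
  Put the factor \<open>(1 - A)\<^sup>-\<^sup>1\<close> of the Moebius map on the left: \<open>\<phi> = \<alpha> - s (1 - A)\<^sup>-\<^sup>1 B\<close>, where \<open>A\<close> and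
  \<open>B\<close> create the conjugates of \<open>w\<close> and of \<open>d\<close>, the image of \<open>u\<close> under the map that is \<open>s\<close> along \<open>w\<close>
  and the identity on its complement.  The order matters: creation operators do not commute, and
  with this order \<open>\<phi>\<close> is \<open>norm u\<close> times an isometry.  The operator \<open>G = \<phi> - \<alpha>\<close> solves \<open>G = A G - s B\<close>;
  this is a contraction on the norm-closed Hardy algebra, so \<open>G\<close> lies there.  The same
  equation yields the norm (take the norm of both sides at a vector) and the values (take the
  inner product with a kernel vector).
\<close>

lemma extremal_operator:
  fixes u w :: "complex ^ 'n::finite"
  assumes w: "norm w < 1"
  obtains \<phi> where "\<phi> \<in> hardy_algebra" "norm \<phi> \<le> norm u"
    "\<And>l. norm l < 1 \<Longrightarrow> hardy_eval \<phi> l = herm (mobius w l) u"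
proof -
  define s where "s = defect w"
  define \<alpha> where "\<alpha> = herm w u"
  define d where "d = u - (cnj \<alpha> / (1 + of_real s)) *s w"
  have s: "s > 0" "s\<^sup>2 = 1 - (norm w)\<^sup>2" "1 + complex_of_real s \<noteq> 0"
    and ww: "herm w w = (1 - of_real s) * (1 + of_real s)"
    using w by (simp_all add: s_def defect_pos defect_sq one_plus_defect_neq_zero herm_self_defect)
  have uw: "herm u w = cnj \<alpha>"
    by (simp add: \<alpha>_def cnj_herm)
  have dw: "herm d w = of_real s * cnj \<alpha>"
    using s(3) by (simp add: d_def herm_diff_left herm_scale_left uw ww) (simp add: algebra_simps)
  have "herm d d = herm u d - cnj \<alpha> / (1 + of_real s) * herm w d"
    by (simp add: d_def herm_diff_left herm_scale_left)
  also have "herm w d = of_real s * \<alpha>"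
    using dw by (metis cnj_herm complex_cnj_mult complex_cnj_complex_of_real complex_cnj_cnj)
  also have "herm u d = herm u u - \<alpha> / (1 + of_real s) * cnj \<alpha>"
    by (simp add: d_def herm_diff_right herm_scale_right uw)
  also have "herm u u - \<alpha> / (1 + of_real s) * cnj \<alpha> - cnj \<alpha> / (1 + of_real s) * (of_real s * \<alpha>) = herm u u - \<alpha> * cnj \<alpha>"
    using s(3) by (simp add: divide_simps) (simp add: algebra_simps)
  finally have "complex_of_real ((norm d)\<^sup>2) = of_real ((norm u)\<^sup>2 - (cmod \<alpha>)\<^sup>2)"
    by (simp add: herm_self flip: complex_norm_square)
  then have nd: "(norm d)\<^sup>2 = (norm u)\<^sup>2 - (cmod \<alpha>)\<^sup>2"
    using of_real_eq_iff by blast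
  define C where "C = create (conj_vec w)"
  define D where "D = op_scale (- of_real s) (create (conj_vec d))"
  have CD: "C \<in> hardy_algebra" "D \<in> hardy_algebra"
    using creation_algebra_hardy create_in_algebra by (auto simp: C_def D_def intro: hardy_scale)
  have "norm C \<le> norm w"
    unfolding C_def by (rule norm_blinfun_bound) (auto simp: create_apply norm_tensor_left)
  then have contr: "norm (C o\<^sub>L G) \<le> norm w * norm G" for G
    by (meson mult_right_mono norm_blinfun_compose norm_ge_zero order_trans)
  have "\<exists>!G\<in>hardy_algebra. (C o\<^sub>L G) + D = G"
  proof (rule Banach_fix[where c = "norm w"])
    show "complete (hardy_algebra :: ('n fock \<Rightarrow>\<^sub>L 'n fock) set)"
      using closed_hardy by (simp add: complete_eq_closed)
    show "(\<lambda>G. (C o\<^sub>L G) + D) ` hardy_algebra \<subseteq> hardy_algebra"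
      using CD by (auto intro: hardy_add hardy_mult)
    show "dist ((C o\<^sub>L G) + D) ((C o\<^sub>L H) + D) \<le> norm w * dist G H" for G H
    proof -
      have "(C o\<^sub>L G) + D - ((C o\<^sub>L H) + D) = C o\<^sub>L (G - H)"
        by (rule blinfun_eqI) (simp add: blinfun.add_left blinfun.diff_left blinfun.diff_right)
      then show ?thesis
        using contr[of "G - H"] by (simp add: dist_norm)
    qed
  qed (use w CD in auto)
  then obtain G where G: "G \<in> hardy_algebra" "(C o\<^sub>L G) + D = G"
    by blast
  define \<phi> where "\<phi> = op_scale \<alpha> id_blinfun + G"
  have id: "id_blinfun \<in> hardy_algebra"
    using creation_algebra_hardy creation_algebra.one by blast
  have \<phi>: "\<phi> \<in> hardy_algebra"
    unfolding \<phi>_def by (intro hardy_add hardy_scale id G)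
  have G_apply: "blinfun_apply G y = tensor_left (conj_vec w) (blinfun_apply G y)
      + - of_real s \<cdot>\<^sub>F tensor_left (conj_vec d) y" for y
  proof -
    have "blinfun_apply G y = blinfun_apply ((C o\<^sub>L G) + D) y"
      by (simp only: G(2))
    then show ?thesis
      by (simp add: blinfun.add_left C_def D_def create_apply op_scale_apply)
  qed
  have \<phi>_apply: "blinfun_apply \<phi> y = \<alpha> \<cdot>\<^sub>F y + blinfun_apply G y" for y
    by (simp add: \<phi>_def blinfun.add_left op_scale_apply)
  have "norm (blinfun_apply \<phi> y) = norm u * norm y" for y
  proof -
    define g where "g = blinfun_apply G y"
    define i where "i = fock_inner g y"
    define c where "c = Re (cnj \<alpha> * i)"
    \<comment> \<open>The vector \<open>g = \<phi> y - \<alpha> y\<close> solves the defining equation; the cross term involves \<open>\<langle>d,w\<rangle> = s (cnj \<alpha>)\<close>,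
      which makes it cancel against the cross term of \<open>|g + \<alpha> y|\<^sup>2\<close>.\<close>
    have w2: "(norm w)\<^sup>2 = 1 - s\<^sup>2"
      using s(2) by simp
    have "g = tensor_left (conj_vec w) g + - of_real s \<cdot>\<^sub>F tensor_left (conj_vec d) y"
      using G_apply[of y] by (simp only: g_def)
    then have "(norm g)\<^sup>2 = (norm (tensor_left (conj_vec w) g + - of_real s \<cdot>\<^sub>F tensor_left (conj_vec d) y))\<^sup>2"
      by (rule arg_cong)
    also have "\<dots> = (norm w)\<^sup>2 * (norm g)\<^sup>2 - 2 * s\<^sup>2 * c + s\<^sup>2 * ((norm d)\<^sup>2 * (norm y)\<^sup>2)"
      unfolding norm_add_squared_fock
      by (simp add: norm_tensor_left norm_fock_scale fock_inner_scale_right fock_inner_tensor_left dw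
          power_mult_distrib c_def flip: i_def) (simp add: power2_eq_square algebra_simps)
    finally have "s\<^sup>2 * (norm g)\<^sup>2 = s\<^sup>2 * ((norm d)\<^sup>2 * (norm y)\<^sup>2 - 2 * c)"
      unfolding w2 by (simp add: algebra_simps)
    then have ng: "(norm g)\<^sup>2 = (norm d)\<^sup>2 * (norm y)\<^sup>2 - 2 * c"
      using s(1) by simp
    have "(norm (blinfun_apply \<phi> y))\<^sup>2 = (norm (g + \<alpha> \<cdot>\<^sub>F y))\<^sup>2"
      by (simp add: \<phi>_apply g_def add.commute)
    also have "\<dots> = (norm g)\<^sup>2 + 2 * c + (cmod \<alpha>)\<^sup>2 * (norm y)\<^sup>2"
      by (simp add: norm_add_squared_fock fock_inner_scale_right norm_fock_scale power_mult_distrib i_def c_def)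
    also have "\<dots> = (norm u * norm y)\<^sup>2"
      by (simp add: ng nd power_mult_distrib algebra_simps)
    finally show ?thesis
      by simp
  qed
  then have norm: "norm \<phi> \<le> norm u"
    by (intro norm_blinfun_bound) auto
  have eval: "hardy_eval \<phi> l = herm (mobius w l) u" if l: "norm l < 1" for l
  proof -
    define t where "t = herm l w"
    define h where "h = fock_inner (blinfun_apply G vacuum) (szego l)"
    have t: "1 - t \<noteq> 0"
      using herm_neq_one[OF l w] by (simp add: t_def)
    have "h = fock_inner (tensor_left (conj_vec w) (blinfun_apply G vacuum)
        + - of_real s \<cdot>\<^sub>F tensor_left (conj_vec d) vacuum) (szego l)"
      using G_apply[of vacuum] by (simp only: h_def)
    also have "\<dots> = t * h - of_real s * herm l d"
      using l by (simp add: fock_inner_add_left fock_inner_scale_left fock_inner_tensor_left_szego t_def h_def)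
    finally have h: "h = - of_real s * herm l d / (1 - t)"
      using t by (simp add: field_simps)
    have ld: "herm l d = herm l u - \<alpha> / (1 + of_real s) * t"
      by (simp add: d_def herm_diff_right herm_scale_right t_def)
    have "hardy_eval \<phi> l = \<alpha> + h"
      using l by (simp add: hardy_eval_eq[OF l \<phi>] \<phi>_apply fock_inner_add_left fock_inner_scale_left h_def)
    also have "\<alpha> + h = (1 / (1 - t)) * (\<alpha> - of_real s * herm l u - t / (1 + of_real s) * \<alpha>)"
      using t s(3) unfolding h ld by (simp add: divide_simps) (simp add: algebra_simps)
    also have "\<dots> = herm (mobius w l) u"
      by (simp only: mobius_def herm_scale_left herm_diff_left s_def t_def \<alpha>_def)
    finally show ?thesis .
  qed
  show ?thesis
    using that[OF \<phi> norm eval] .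
qed

theorem proposition1p9:
  fixes z w :: "complex ^ 'n::finite"
  assumes "z \<in> ball 0 1" and "w \<in> ball 0 1"
  shows "is_maximum (pseudohyperbolic_dist z w)
    {cmod (hardy_eval \<phi> z) | \<phi>. \<phi> \<in> hardy_algebra \<and> norm \<phi> \<le> 1 \<and> hardy_eval \<phi> w = 0}"
proof -
  have z: "norm z < 1" and w: "norm w < 1"
    using assms by auto
  define m where "m = mobius w z"
  \<comment> \<open>a unit vector, or \<open>0\<close> when \<open>z = w\<close>; then the operator obtained below is \<open>0\<close>, still extremal\<close>
  define u where "u = inverse (of_real (norm m)) *s m"
  \<comment> \<open>The extremal operator involves \<open>mobius w z\<close>, the distance \<open>mobius z w\<close>; their norms agree.\<close>
  have sym: "norm m = norm (mobius z w)"
  proof -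
    have "cmod (1 - herm z w) = cmod (1 - herm w z)"
      by (metis cnj_herm complex_cnj_diff complex_cnj_one complex_mod_cnj)
    then have "1 - (norm m)\<^sup>2 = 1 - (norm (mobius z w))\<^sup>2"
      unfolding m_def norm_mobius[OF z w] norm_mobius[OF w z] by (simp add: mult.commute)
    then show ?thesis
      by simp
  qed
  have u: "norm u \<le> 1"
    by (cases "m = 0") (simp_all add: u_def norm_cscale norm_inverse)
  obtain \<phi> where \<phi>: "\<phi> \<in> hardy_algebra" "norm \<phi> \<le> norm u"
    "\<And>l. norm l < 1 \<Longrightarrow> hardy_eval \<phi> l = herm (mobius w l) u"
    using extremal_operator[OF w] by blast
  have "hardy_eval \<phi> w = 0"
    using \<phi>(3)[OF w] by (simp add: mobius_self[OF w])
  moreover have "hardy_eval \<phi> z = of_real (norm m)"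
    unfolding \<phi>(3)[OF z] m_def[symmetric] u_def
    by (cases "m = 0") (simp_all add: herm_scale_right herm_self power2_eq_square)
  then have "cmod (hardy_eval \<phi> z) = pseudohyperbolic_dist z w"
    by (simp add: pseudohyperbolic_dist_eq[OF z w] sym)
  ultimately have "\<exists>\<phi>. pseudohyperbolic_dist z w = cmod (hardy_eval \<phi> z) \<and>
      \<phi> \<in> hardy_algebra \<and> norm \<phi> \<le> 1 \<and> hardy_eval \<phi> w = 0"
    using \<phi>(1,2) u by (intro exI[of _ \<phi>]) auto
  then show ?thesis
    using hardy_eval_le_mobius[OF z w] by (auto simp: is_maximum_def pseudohyperbolic_dist_eq[OF z w])
qed

end
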